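(* Let $\Omega$ be a bounded open convex domain in $\mathbb{R}^n$. There exists a constant $C=C(n,\Omega)$ depending only on $n$ and $\Omega$ such that, whenever $u,v\in C(\overline\Omega)$ are nonzero convex eigenfunctions of the problem $$\det D^2w=\lambda[\Omega]\,|w|^n\ \text{in }\Omega,\qquad w=0\ \text{on }\partial\Omega$$ (that is, both $w=u$ and $w=v$ solve this problem), one has $$\int_\Omega\Delta u\,|v|^{n-1}\,dx\le C\,\|u\|_{L^\infty(\Omega)}\,\|v\|_{L^\infty(\Omega)}^{n-1}.$$
   Context: The dimension $n\ge2$ is fixed. All bounded open convex domains are assumed to have nonempty interior. For a bounded open convex domain $\Omega\subset\mathbb{R}^n$, the Monge-Ampère eigenvalue is $$\lambda[\Omega]=\inf\left\{\frac{\int_\Omega(-u)\det D^2u\,dx}{\int_\Omega(-u)^{n+1}\,dx}: u\in C(\overline\Omega),\ u \text{ convex, nonzero in }\Omega,\ u=0\text{ on }\partial\Omega\right\}.$$ Here $\det D^2u\,dx$ denotes the Monge-Ampère measure $Mu(E)=|\partial u(E)|$ ($E\subset\Omega$ Borel, $|\cdot|$ Lebesgue measure), where $\partial u(E)=\bigcup_{x\in E}\partial u(x)$ and $\partial u(x)=\{p\in\mathbb{R}^n:u(y)\ge u(x)+p\cdot(y-x)\ \forall y\in\Omega\}$. The equation $\det D^2w=f$ is understood in the Aleksandrov sense, $Mw=f\,dx$ as Borel measures. Nonzero convex functions $w\in C(\overline\Omega)$ solving $\det D^2w=\lambda[\Omega]\,|w|^n$ in $\Omega$ with $w=0$ on $\partial\Omega$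 belong to $C^\infty(\Omega)$ by interior regularity, so $\Delta u$ is the classical Laplacian. *)

theory Defs
  imports "HOL-Analysis.Analysis" "HOL-Probability.Essential_Supremum"
begin

definition subdifferential :: "'a::euclidean_space set \<Rightarrow> ('a \<Rightarrow> real) \<Rightarrow> 'a \<Rightarrow> 'a set" where
  "subdifferential \<Omega> u x = {p. \<forall>y\<in>\<Omega>. u y \<ge> u x + p \<bullet> (y - x)}"

(* The completed measure is used because the image of a Borel set under the subdifferential
   of a convex function is Lebesgue measurable, but need not be Borel. *)
definition monge_ampere :: "'a::euclidean_space set \<Rightarrow> ('a \<Rightarrow> real) \<Rightarrow> 'a set \<Rightarrow> ennreal" where
  "monge_ampere \<Omega> u E = emeasure lebesgue (\<Union>x\<in>E. subdifferential \<Omega> u x)"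

definition monge_ampere_measure :: "'a::euclidean_space set \<Rightarrow> ('a \<Rightarrow> real) \<Rightarrow> 'a measure" where
  "monge_ampere_measure \<Omega> u = measure_of \<Omega> {E \<in> sets borel. E \<subseteq> \<Omega>} (monge_ampere \<Omega> u)"

definition admissible :: "'a::euclidean_space set \<Rightarrow> ('a \<Rightarrow> real) \<Rightarrow> bool" where
  "admissible \<Omega> u \<longleftrightarrow>
     continuous_on (closure \<Omega>) u \<and> convex_on \<Omega> u \<and> (\<exists>x\<in>\<Omega>. u x \<noteq> 0) \<and> (\<forall>x\<in>frontier \<Omega>. u x = 0)"

(* Admissible functions are negative in a bounded convex domain, so nothing is cut off by
   ennreal below, and the denominator is positive and finite. The numerator may be infinite,
   hence the values in the extended nonnegative reals. *)
definition ma_eigenvalue :: "'a::euclidean_space set \<Rightarrow> ennreal" where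
  "ma_eigenvalue \<Omega> =
     (INF u\<in>{u. admissible \<Omega> u}.
        (\<integral>\<^sup>+x. ennreal (- u x) \<partial>monge_ampere_measure \<Omega> u) /
        (\<integral>\<^sup>+x\<in>\<Omega>. ennreal ((- u x) ^ (DIM('a) + 1)) \<partial>lborel))"

(* The Aleksandrov equation det D^2 w = f in \<Omega>: equality of Borel measures on \<Omega>. *)
definition aleksandrov_solution ::
  "'a::euclidean_space set \<Rightarrow> ('a \<Rightarrow> ennreal) \<Rightarrow> ('a \<Rightarrow> real) \<Rightarrow> bool" where
  "aleksandrov_solution \<Omega> f w \<longleftrightarrow>
     (\<forall>E\<in>sets borel. E \<subseteq> \<Omega> \<longrightarrow> monge_ampere \<Omega> w E = (\<integral>\<^sup>+x\<in>E. f x \<partial>lborel))"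

definition ma_eigenfunction :: "'a::euclidean_space set \<Rightarrow> ('a \<Rightarrow> real) \<Rightarrow> bool" where
  "ma_eigenfunction \<Omega> w \<longleftrightarrow> admissible \<Omega> w \<and>
     aleksandrov_solution \<Omega> (\<lambda>x. ma_eigenvalue \<Omega> * ennreal (\<bar>w x\<bar> ^ DIM('a))) w"

definition twice_differentiable_at :: "('a::euclidean_space \<Rightarrow> real) \<Rightarrow> 'a \<Rightarrow> bool" where
  "twice_differentiable_at u x \<longleftrightarrow>
     (\<forall>\<^sub>F y in nhds x. u differentiable (at y)) \<and>
     (\<forall>b\<in>Basis. (\<lambda>y. frechet_derivative u (at y) b) differentiable (at x))"

(* The classical Laplacian, with value 0 by convention where u is not twice differentiable
   (frechet_derivative is arbitrary there). *)
definition laplacian :: "('a::euclidean_space \<Rightarrow> real) \<Rightarrow> 'a \<Rightarrow> real" where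
  "laplacian u x =
     (if twice_differentiable_at u x
      then \<Sum>b\<in>Basis. frechet_derivative (\<lambda>y. frechet_derivative u (at y) b) (at x) b
      else 0)"

definition Linf_norm :: "'a::euclidean_space set \<Rightarrow> ('a \<Rightarrow> real) \<Rightarrow> ennreal" where
  "Linf_norm \<Omega> u = esssup (restrict_space lborel \<Omega>) (\<lambda>x. ennreal \<bar>u x\<bar>)"

end

theory Submission
  imports Defs
begin

text \<open>
  Write n for the dimension, d for the distance of x to the boundary, and s for the (n + 1)-st
  root of d. Two facts carry the proof, and the exponents in them fit together exactly.

  Boundary decay (\<open>eigenfunction_boundary_decay\<close>): an eigenfunction v bounded by M satisfies
  |v| \<le> C M s^2. Add to v the linear function that vanishes on a supporting hyperplane near x and
  equals M at distance h from it. The tilted function is negative only in a slab of width h, so all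
  the slopes that the Aleksandrov argument produces at x belong to points of that slab. There the
  Monge-Ampere mass is at most a constant times h M^n, because the density is \<lambda> |v|^n. Hence
  (|v(x)| - (M/h) d)^n \<le> C d h M^n, and the choice h = s^(n-1) makes both errors of size M s^2.
  Compared with the exponent 1/n of the plain Aleksandrov estimate, this gains what is needed below.

  Integration over slopes (\<open>weighted_second_difference_integral_le\<close>): by convexity, a slope q of
  u at x in a coordinate direction satisfies |q| \<le> |u|/d \<le> A / s^(n-1) with A = C \<parallel>u\<parallel>, while the
  weight g = |v|^(n-1) is at most B s^(2(n-1)) with B = (C \<parallel>v\<parallel>)^(n-1). Thus g (1 + (q/A)^2) is
  bounded by a multiple of B, so that on each line g dq is at most a multiple of
  A B d(arctan(q/A)), whose total variation is at most \<pi> A B whatever u is. Summing over lines and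
  over the coordinate directions gives the estimate.

  The second step is carried out with second difference quotients of step t instead of
  derivatives. They make sense for every convex function, the sum over a line telescopes after an
  integration over the domain, and at points of twice differentiability they converge to the second
  derivatives. Fatou's lemma then transfers the bound to the classical Laplacian.

  The volume estimates that arise are all obtained by packing disjoint translates of a set, which
  avoids rotating coordinates and slicing by Fubini's theorem.
\<close>

section \<open>Volume bounds from disjoint translates\<close>

lemma emeasure_lborel_image_plus:
  fixes A :: "'a::euclidean_space set"
  assumes "A \<in> sets borel"
  shows "(+) c ` A \<in> sets borel" and "emeasure lborel ((+) c ` A) = emeasure lborel A"
proof -
  have eq: "(+) c ` A = (+) (- c) -` A"
    by (force simp: image_iff)
  have meas: "(+) (- c) \<in> borel_measurable (borel :: 'a measure)"
    by (intro borel_measurable_continuous_onI continuous_intros)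
  show "(+) c ` A \<in> sets borel"
    using measurable_sets[OF meas assms] by (simp add: eq)
  have "emeasure lborel A = emeasure (distr lborel borel ((+) (- c))) A"
    by (simp add: lborel_distr_plus)
  also have "\<dots> = emeasure lborel ((+) c ` A)"
    using meas assms by (simp add: emeasure_distr eq)
  finally show "emeasure lborel ((+) c ` A) = emeasure lborel A" by simp
qed

lemma emeasure_disjoint_translates_le:
  fixes A B :: "'a::euclidean_space set"
  assumes A: "A \<in> sets borel" and B: "B \<in> sets borel"
    and sub: "\<And>j a. j < N \<Longrightarrow> a \<in> A \<Longrightarrow> a + real j *\<^sub>R c \<in> B"
    and ndisj: "\<And>j a. 0 < j \<Longrightarrow> j < N \<Longrightarrow> a \<in> A \<Longrightarrow> a + real j *\<^sub>R c \<notin> A"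
  shows "of_nat N * emeasure lborel A \<le> emeasure lborel B"
proof -
  define T where "T j = (+) (real j *\<^sub>R c) ` A" for j :: nat
  have T: "T j \<in> sets lborel" "emeasure lborel (T j) = emeasure lborel A" for j
    unfolding T_def sets_lborel by (fact emeasure_lborel_image_plus[OF A])+
  have ord: "T i \<inter> T j = {}" if "i < j" "j < N" for i j
  proof -
    have False if "a \<in> A" "b \<in> A" "real i *\<^sub>R c + a = real j *\<^sub>R c + b" for a b
    proof -
      have "a = b + real (j - i) *\<^sub>R c"
        using that \<open>i < j\<close> by (simp add: of_nat_diff algebra_simps)
      then show False
        using ndisj[of "j - i" b] that \<open>i < j\<close> \<open>j < N\<close> by auto
    qed
    then show ?thesis by (auto simp: T_def)
  qed
  have "disjoint_family_on T {..<N}"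
    unfolding disjoint_family_on_def
    by (metis Int_commute lessThan_iff linorder_neqE_nat ord)
  then have "emeasure lborel (\<Union>j<N. T j) = (\<Sum>j<N. emeasure lborel (T j))"
    by (subst sum_emeasure) (use T in auto)
  then have "of_nat N * emeasure lborel A = emeasure lborel (\<Union>j<N. T j)"
    by (simp add: T)
  also have "\<dots> \<le> emeasure lborel B"
    using sub B by (intro emeasure_mono) (auto simp: T_def add.commute)
  finally show ?thesis .
qed

text \<open>If the translates of A by the multiples of h c with coefficient up to 1 are disjoint and stay in
  B, then about 1/h copies of A fit into B. This bounds the volume of sets that are thin of order h
  in the direction c, without a description of their cross sections.\<close>

lemma emeasure_le_step_mult:
  fixes A B :: "'a::euclidean_space set"
  assumes A: "A \<in> sets borel" and B: "B \<in> sets borel" and h: "h > 0"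
    and sub: "\<And>j a. real j * h \<le> 1 \<Longrightarrow> a \<in> A \<Longrightarrow> a + (real j * h) *\<^sub>R c \<in> B"
    and ndisj: "\<And>j a. 0 < j \<Longrightarrow> a \<in> A \<Longrightarrow> a + (real j * h) *\<^sub>R c \<notin> A"
  shows "emeasure lborel A \<le> ennreal h * emeasure lborel B"
proof -
  \<comment> \<open>Rounding up is harmless: the last translate used has index N - 1, and (N - 1) h < 1.\<close>
  define N where "N = nat \<lceil>1 / h\<rceil>"
  have N1: "1 \<le> h * real N"
  proof -
    have "1 / h \<le> real N"
      unfolding N_def using h by (metis of_nat_ceiling)
    then show ?thesis using h by (simp add: field_simps)
  qed
  have N2: "real j * h \<le> 1" if "j < N" for j
  proof -
    have "real j < 1 / h" using that h unfolding N_def by linarith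
    then show ?thesis using h by (simp add: field_simps)
  qed
  have "of_nat N * emeasure lborel A \<le> emeasure lborel B"
    by (rule emeasure_disjoint_translates_le[OF A B, where c = "h *\<^sub>R c"])
      (use sub ndisj N2 in auto)
  then have "ennreal h * (of_nat N * emeasure lborel A) \<le> ennreal h * emeasure lborel B"
    by (rule mult_left_mono) simp
  moreover have "ennreal h * (of_nat N * emeasure lborel A) = ennreal (h * real N) * emeasure lborel A"
    using h by (simp add: ennreal_mult mult.assoc ennreal_of_nat_eq_real_of_nat)
  moreover have "1 * emeasure lborel A \<le> ennreal (h * real N) * emeasure lborel A"
    using N1 by (intro mult_right_mono) (auto simp: ennreal_1[symmetric] simp del: ennreal_1 intro!: ennreal_leI)
  ultimately show ?thesis by simp
qed

lemma emeasure_slab_le: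
  fixes e z :: "'a::euclidean_space"
  assumes S: "S \<in> sets borel" "S \<subseteq> cball x R" and e: "norm e = 1" and h: "h > 0"
    and slab: "\<And>y. y \<in> S \<Longrightarrow> 0 \<le> e \<bullet> (y - z) \<and> e \<bullet> (y - z) < h"
  shows "emeasure lborel S \<le> ennreal h * emeasure lborel (cball x (R + 1))"
proof (rule emeasure_le_step_mult[where c = e])
  fix j :: nat and a assume a: "a \<in> S"
  show "a + (real j * h) *\<^sub>R e \<in> cball x (R + 1)" if "real j * h \<le> 1"
  proof -
    have "dist x (a + (real j * h) *\<^sub>R e) \<le> dist x a + dist a (a + (real j * h) *\<^sub>R e)"
      by (rule dist_triangle)
    also have "\<dots> \<le> R + 1"
      using a S that e h by (intro add_mono) (auto simp: dist_norm)
    finally show ?thesis by simp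
  qed
  show "a + (real j * h) *\<^sub>R e \<notin> S" if "0 < j"
  proof
    assume "a + (real j * h) *\<^sub>R e \<in> S"
    from slab[OF this] have "e \<bullet> (a - z) + real j * h < h"
      using e by (simp add: inner_diff_right inner_add_right norm_eq_1)
    moreover have "h \<le> real j * h" using that h by simp
    ultimately show False using slab[OF a] by linarith
  qed
qed (use S h in auto)

text \<open>A set containing the r-neighbourhood of a segment of length T contains about T/(2r) disjoint
  balls of radius r strung along that segment. Applied to the set of slopes below, which is long in
  the direction of the inner normal.\<close>

lemma emeasure_ball_chain_le:
  fixes P :: "'a::euclidean_space set"
  assumes P: "P \<in> sets borel" and e: "norm e = 1" and r: "r > 0" and T: "T > 0"
    and sub: "\<And>a s. norm a < r \<Longrightarrow> 0 \<le> s \<Longrightarrow> s \<le> T \<Longrightarrow> a - s *\<^sub>R e \<in> P"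
  shows "ennreal (T / (2 * r) * r ^ DIM('a) * measure lborel (ball (0::'a) 1)) \<le> emeasure lborel P"
proof -
  define N where "N = nat \<lceil>T / (2 * r)\<rceil>"
  have N1: "T / (2 * r) \<le> real N"
    unfolding N_def by (metis of_nat_ceiling)
  have N2: "real j * (2 * r) \<le> T" if "j < N" for j
  proof -
    have "real j < T / (2 * r)" using that r T unfolding N_def by linarith
    then show ?thesis using r by (simp add: field_simps)
  qed
  have le: "of_nat N * emeasure lborel (ball (0::'a) r) \<le> emeasure lborel P"
  proof (rule emeasure_disjoint_translates_le[OF _ P, where c = "- ((2 * r) *\<^sub>R e)"])
    fix j :: nat and a :: 'a
    show "a + real j *\<^sub>R - ((2 * r) *\<^sub>R e) \<in> P" if "j < N" "a \<in> ball 0 r"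
      using sub[of a "real j * (2 * r)"] that N2[of j] r by auto
    show "a + real j *\<^sub>R - ((2 * r) *\<^sub>R e) \<notin> ball 0 r" if "0 < j" "a \<in> ball 0 r"
    proof -
      have "real j * (2 * r) = norm ((real j * (2 * r)) *\<^sub>R e)"
        using e r by simp
      also have "\<dots> \<le> norm a + norm (a + real j *\<^sub>R - ((2 * r) *\<^sub>R e))"
        using norm_triangle_ineq4[of a "a + real j *\<^sub>R - ((2 * r) *\<^sub>R e)"] by simp
      finally have "real j * (2 * r) \<le> norm a + norm (a + real j *\<^sub>R - ((2 * r) *\<^sub>R e))" .
      moreover have "2 * r \<le> real j * (2 * r)"
        using that r by simp
      ultimately show ?thesis using that by auto
    qed
  qed simp
  have "measure lborel (ball (0::'a) r) = r ^ DIM('a) * measure lborel (ball (0::'a) 1)"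
    using r by (intro content_ball_conv_unit_ball) simp
  moreover have "emeasure lborel (ball (0::'a) r) = ennreal (measure lborel (ball (0::'a) r))"
    by (intro emeasure_eq_ennreal_measure) (use emeasure_bounded_finite[of "ball (0::'a) r"] in auto)
  ultimately have eq: "of_nat N * emeasure lborel (ball (0::'a) r)
      = ennreal (real N * (r ^ DIM('a) * measure lborel (ball (0::'a) 1)))"
    using r by (simp add: ennreal_mult ennreal_of_nat_eq_real_of_nat)
  have "T / (2 * r) * r ^ DIM('a) * measure lborel (ball (0::'a) 1)
      \<le> real N * (r ^ DIM('a) * measure lborel (ball (0::'a) 1))"
    unfolding mult.assoc using N1 r by (intro mult_right_mono) auto
  then show ?thesis
    using le unfolding eq by (meson ennreal_leI order_trans)
qed

section \<open>Subdifferentials and the sign of admissible functions\<close>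

text \<open>The image of a compact set is the projection, along a compact factor, of the closed set of pairs
  (x, p) with p a subgradient at x. Closedness makes the image measurable, so the Monge-Ampere measure
  of a compact set really is the volume of its slopes and can be bounded from below.\<close>

lemma closed_subdifferential_image:
  fixes u :: "'a::euclidean_space \<Rightarrow> real"
  assumes E: "compact E" "E \<subseteq> \<Omega>" and u: "continuous_on \<Omega> u"
  shows "closed (\<Union>x\<in>E. subdifferential \<Omega> u x)"
proof -
  have "closed ({z. fst z \<in> E} \<inter> {z. u (fst z) + snd z \<bullet> (y - fst z) \<le> u y} :: ('a \<times> 'a) set)" for y
  proof -
    have "closed ((E \<times> UNIV) \<inter> (\<lambda>z. u (fst z) + snd z \<bullet> (y - fst z)) -` {..u y})"
      by (rule continuous_closed_preimage)
        (auto intro!: continuous_intros closed_Times compact_imp_closed[OF E(1)]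
          continuous_on_compose2[OF continuous_on_subset[OF u E(2)]])
    moreover have "(E \<times> UNIV) \<inter> (\<lambda>z. u (fst z) + snd z \<bullet> (y - fst z)) -` {..u y}
      = ({z. fst z \<in> E} \<inter> {z. u (fst z) + snd z \<bullet> (y - fst z) \<le> u y} :: ('a \<times> 'a) set)"
      by auto
    ultimately show ?thesis by simp
  qed
  then have "closed (\<Inter>y\<in>\<Omega>. {z. fst z \<in> E} \<inter> {z. u (fst z) + snd z \<bullet> (y - fst z) \<le> u y} :: ('a \<times> 'a) set)"
    by (intro closed_INT ballI)
  from closed_compact_projection[OF E(1) this]
  have cl: "closed {p. \<exists>x. x \<in> E \<and> (x, p) \<in> (\<Inter>y\<in>\<Omega>. {z. fst z \<in> E} \<inter> {z. u (fst z) + snd z \<bullet> (y - fst z) \<le> u y})}" .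
  have "{p. \<exists>x. x \<in> E \<and> (x, p) \<in> (\<Inter>y\<in>\<Omega>. {z. fst z \<in> E} \<inter> {z. u (fst z) + snd z \<bullet> (y - fst z) \<le> u y})}
     = (\<Union>x\<in>E. subdifferential \<Omega> u x)"
    by (auto simp: subdifferential_def)
  with cl show ?thesis by simp
qed

text \<open>A convex function that attains its maximum at an interior point is constant: each y, together
  with a point slightly beyond the maximum on the opposite side, has the maximum as a convex
  combination. The constant is then the boundary value.\<close>

lemma admissible_nonpos:
  fixes v :: "'a::euclidean_space \<Rightarrow> real"
  assumes \<Omega>: "open \<Omega>" "bounded \<Omega>" "\<Omega> \<noteq> {}" and v: "admissible \<Omega> v" and x: "x \<in> closure \<Omega>"
  shows "v x \<le> 0"
proof -
  have "compact (closure \<Omega>)" "closure \<Omega> \<noteq> {}"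
    using \<Omega> by auto
  moreover have cont: "continuous_on (closure \<Omega>) v" and conv: "convex_on \<Omega> v"
    and bd: "\<And>x. x \<in> frontier \<Omega> \<Longrightarrow> v x = 0"
    using v by (auto simp: admissible_def)
  ultimately obtain x0 where x0: "x0 \<in> closure \<Omega>" and max: "\<And>y. y \<in> closure \<Omega> \<Longrightarrow> v y \<le> v x0"
    using continuous_attains_sup by metis
  have "v x0 \<le> 0"
  proof (cases "x0 \<in> \<Omega>")
    case False
    then show ?thesis using x0 bd \<Omega>(1) by (auto simp: frontier_def interior_open)
  next
    case True
    have eq: "v y = v x0" if y: "y \<in> \<Omega>" for y
    proof -
      obtain r where r: "r > 0" "ball x0 r \<subseteq> \<Omega>"
        using \<Omega>(1) True openE by metis
      define t where "t = r / (1 + norm (y - x0)) / 2"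
      have t: "t > 0" and tn: "t * norm (y - x0) < r"
      proof -
        show "t > 0" using r by (simp add: t_def add_pos_nonneg)
        have "0 \<le> r * norm (y - x0)" using r by simp
        then show "t * norm (y - x0) < r"
          using r unfolding t_def by (simp add: divide_simps) (smt (verit) norm_ge_zero zero_le_mult_iff)
      qed
      define y' where "y' = x0 - t *\<^sub>R (y - x0)"
      have y': "y' \<in> \<Omega>"
        using r(2) tn t by (auto simp: y'_def dist_norm subset_iff)
      have comb: "x0 = (1 / (1 + t)) *\<^sub>R y' + (t / (1 + t)) *\<^sub>R y"
      proof -
        have "(1 / (1 + t)) *\<^sub>R y' + (t / (1 + t)) *\<^sub>R y = (1 / (1 + t)) *\<^sub>R (y' + t *\<^sub>R y)"
          by (simp add: scaleR_add_right)
        also have "\<dots> = (1 / (1 + t)) *\<^sub>R ((1 + t) *\<^sub>R x0)"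
          by (simp add: y'_def algebra_simps)
        finally show ?thesis using t by simp
      qed
      have "v x0 \<le> (1 / (1 + t)) * v y' + (t / (1 + t)) * v y"
        using convex_onD[OF conv, of "t / (1 + t)" y' y] y y' t comb
        by (simp add: add_divide_distrib[symmetric] diff_divide_eq_iff)
      also have "\<dots> \<le> (1 / (1 + t)) * v x0 + (t / (1 + t)) * v y"
        using max[of y'] y' closure_subset t by (intro add_right_mono mult_left_mono) auto
      finally have "(1 + t) * v x0 \<le> (1 + t) * ((1 / (1 + t)) * v x0 + (t / (1 + t)) * v y)"
        using t by (intro mult_left_mono) auto
      also have "\<dots> = v x0 + t * v y"
        using t by (simp add: distrib_left)
      finally have "t * v x0 \<le> t * v y"
        by (simp add: distrib_right)
      then show ?thesis
        using t max[of y] y closure_subset by force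
    qed
    have "frontier \<Omega> \<noteq> {}"
      using \<Omega> by (metis frontier_eq_empty not_bounded_UNIV)
    then obtain z where z: "z \<in> frontier \<Omega>" by auto
    then have "z \<in> closure \<Omega>" by (simp add: frontier_def)
    from continuous_constant_on_closure[OF cont eq this] have "v z = v x0" by simp
    with bd[OF z] show ?thesis by simp
  qed
  with max[OF x] show ?thesis by simp
qed

section \<open>Aleksandrov estimate localised to a slab, and boundary decay\<close>

text \<open>Let w be v plus M/h times the distance e \<bullet> (y - z) to the hyperplane. It is nonnegative on the
  boundary and outside the slab of width h. If a slope p moves by at most m/2 over the domain as seen
  from x, where w(x) = -m, then w - p \<bullet> (y - x) has its minimum at a point with w \<le> -m/2, which
  therefore lies in the slab, and p is a subgradient of w there. Such p include all vectors a - s e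
  with |a| \<le> m/(4R) and 0 \<le> s \<le> m/(4d), since the domain extends only by d beyond x in the
  direction -e. This elongation by R/d is the source of the factor d in the decay estimate.
  The set E is kept compact so that its image under the subdifferential is measurable.\<close>

lemma aleksandrov_halfspace_estimate:
  fixes v :: "'a::euclidean_space \<Rightarrow> real"
  assumes \<Omega>: "open \<Omega>" "bounded \<Omega>" and v: "admissible \<Omega> v" and x: "x \<in> \<Omega>"
    and R: "R > 0" "\<And>y. y \<in> \<Omega> \<Longrightarrow> norm (y - x) \<le> R"
    and e: "norm e = 1" and half: "\<And>y. y \<in> \<Omega> \<Longrightarrow> 0 \<le> e \<bullet> (y - z)"
    and d: "d = e \<bullet> (x - z)" "d > 0"
    and M: "M \<ge> 0" "\<And>y. y \<in> \<Omega> \<Longrightarrow> - M \<le> v y"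
    and h: "h > 0" and m: "m = - v x - M / h * d" "m > 0"
  shows "\<exists>E. compact E \<and> E \<subseteq> \<Omega> \<and> (\<forall>y\<in>E. e \<bullet> (y - z) < h) \<and>
    ennreal (R / (2 * d) * (m / (4 * R)) ^ DIM('a) * measure lborel (ball (0::'a) 1))
      \<le> monge_ampere \<Omega> v E"
proof -
  define K where "K = M / h"
  have K: "K \<ge> 0" using M h by (simp add: K_def)
  define w where "w y = v y + K * (e \<bullet> (y - z))" for y
  have cont: "continuous_on (closure \<Omega>) v" and bd: "\<And>y. y \<in> frontier \<Omega> \<Longrightarrow> v y = 0"
    using v by (auto simp: admissible_def)
  have contw: "continuous_on (closure \<Omega>) w"
    unfolding w_def by (intro continuous_intros cont)
  have half': "0 \<le> e \<bullet> (y - z)" if "y \<in> closure \<Omega>" for y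
  proof -
    have "closed {y. e \<bullet> z \<le> e \<bullet> y}" by (rule closed_halfspace_ge)
    moreover have "\<Omega> \<subseteq> {y. e \<bullet> z \<le> e \<bullet> y}" using half by (auto simp: inner_diff_right)
    ultimately have "closure \<Omega> \<subseteq> {y. e \<bullet> z \<le> e \<bullet> y}" by (intro closure_minimal)
    then show ?thesis using that by (auto simp: inner_diff_right)
  qed
  have R': "norm (y - x) \<le> R" if "y \<in> closure \<Omega>" for y
  proof -
    have "\<Omega> \<subseteq> cball x R" using R by (auto simp: dist_norm norm_minus_commute)
    then have "closure \<Omega> \<subseteq> cball x R" by (simp add: closure_minimal)
    then show ?thesis using that by (auto simp: dist_norm norm_minus_commute)
  qed
  define E where "E = closure \<Omega> \<inter> w -` {.. - m / 2}"
  have "closed E"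
    unfolding E_def by (rule continuous_closed_preimage[OF contw]) auto
  then have E: "compact E"
    using \<Omega>(2) by (auto simp: E_def compact_eq_bounded_closed intro: bounded_subset[OF bounded_closure])
  have E\<Omega>: "E \<subseteq> \<Omega>"
  proof
    fix y assume y: "y \<in> E"
    show "y \<in> \<Omega>"
    proof (rule ccontr)
      assume "y \<notin> \<Omega>"
      then have "y \<in> frontier \<Omega>" using y \<Omega> by (auto simp: E_def frontier_def interior_open)
      then have "w y \<ge> 0" using bd half'[of y] y K by (simp add: w_def E_def)
      then show False using y m by (simp add: E_def)
    qed
  qed
  have Eslab: "e \<bullet> (y - z) < h" if y: "y \<in> E" for y
  proof (rule ccontr)
    assume "\<not> e \<bullet> (y - z) < h"
    then have "K * h \<le> K * (e \<bullet> (y - z))" using K by (intro mult_left_mono) auto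
    moreover have "K * h = M" using h by (simp add: K_def)
    ultimately have "w y \<ge> 0" using M(2)[of y] y E\<Omega> by (auto simp: w_def)
    then show False using y m by (simp add: E_def)
  qed
  define P where "P = {p. \<forall>y\<in>closure \<Omega>. p \<bullet> (y - x) \<le> m / 2}"
  have "closed (\<Inter>y\<in>closure \<Omega>. {p. (y - x) \<bullet> p \<le> m / 2})"
    by (intro closed_INT ballI closed_halfspace_le)
  moreover have "(\<Inter>y\<in>closure \<Omega>. {p. (y - x) \<bullet> p \<le> m / 2}) = P"
    by (auto simp: P_def inner_commute)
  ultimately have P: "P \<in> sets borel" by simp
  define D where "D = (\<Union>y\<in>E. subdifferential \<Omega> v y)"
  have "closed D"
    unfolding D_def using E E\<Omega> cont
    by (intro closed_subdifferential_image) (auto intro: continuous_on_subset[OF _ closure_subset])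
  then have D: "D \<in> sets borel" by simp
  have "R / (2 * d) = (m / (4 * d)) / (2 * (m / (4 * R)))"
    using m R d by (simp add: field_simps)
  then have "ennreal (R / (2 * d) * (m / (4 * R)) ^ DIM('a) * measure lborel (ball (0::'a) 1))
     = ennreal ((m / (4 * d)) / (2 * (m / (4 * R))) * (m / (4 * R)) ^ DIM('a) * measure lborel (ball (0::'a) 1))"
    by simp
  also have "\<dots> \<le> emeasure lborel P"
  proof (rule emeasure_ball_chain_le[OF P e])
    show "m / (4 * R) > 0" "m / (4 * d) > 0" using m R d by auto
    fix a :: 'a and s :: real
    assume a: "norm a < m / (4 * R)" and s: "0 \<le> s" "s \<le> m / (4 * d)"
    show "a - s *\<^sub>R e \<in> P"
      unfolding P_def
    proof (intro CollectI ballI)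
      fix y assume y: "y \<in> closure \<Omega>"
      have "a \<bullet> (y - x) \<le> norm a * norm (y - x)" by (rule norm_cauchy_schwarz)
      also have "\<dots> \<le> m / (4 * R) * R" using a R'[OF y] R m by (intro mult_mono) auto
      finally have 1: "a \<bullet> (y - x) \<le> m / 4" using R by simp
      have "- d \<le> e \<bullet> (y - x)" using half'[OF y] d by (simp add: inner_diff_right)
      then have "s * - d \<le> s * (e \<bullet> (y - x))" using s by (intro mult_left_mono)
      moreover have "s * d \<le> m / (4 * d) * d" using s d by (intro mult_right_mono) auto
      ultimately have "- (s * (e \<bullet> (y - x))) \<le> m / 4" using d by simp
      with 1 show "(a - s *\<^sub>R e) \<bullet> (y - x) \<le> m / 2" by (simp add: inner_diff_left)
    qed
  qed
  also have "\<dots> = emeasure lborel ((+) (- (K *\<^sub>R e)) ` P)"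
    by (simp only: emeasure_lborel_image_plus(2)[OF P])
  also have "\<dots> \<le> emeasure lborel D"
  proof (rule emeasure_mono)
    show "(+) (- (K *\<^sub>R e)) ` P \<subseteq> D"
    proof safe
      fix p assume p: "p \<in> P"
      have "compact (closure \<Omega>)" "closure \<Omega> \<noteq> {}" using \<Omega> x by auto
      moreover have "continuous_on (closure \<Omega>) (\<lambda>y. w y - p \<bullet> (y - x))"
        by (intro continuous_intros contw)
      ultimately obtain y0 where y0: "y0 \<in> closure \<Omega>"
        and min: "\<And>y. y \<in> closure \<Omega> \<Longrightarrow> w y0 - p \<bullet> (y0 - x) \<le> w y - p \<bullet> (y - x)"
        using continuous_attains_inf[of "closure \<Omega>" "\<lambda>y. w y - p \<bullet> (y - x)"] by blast
      have "w x = - m" using m by (simp add: w_def K_def d)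
      then have "w y0 - p \<bullet> (y0 - x) \<le> - m"
        using min[of x] x closure_subset by auto
      moreover have "p \<bullet> (y0 - x) \<le> m / 2" using p y0 by (auto simp: P_def)
      ultimately have "w y0 \<le> - m / 2" by linarith
      then have "y0 \<in> E" using y0 by (simp add: E_def)
      moreover have "- (K *\<^sub>R e) + p \<in> subdifferential \<Omega> v y0"
        unfolding subdifferential_def
      proof (intro CollectI ballI)
        fix y assume "y \<in> \<Omega>"
        then have "w y0 - p \<bullet> (y0 - x) \<le> w y - p \<bullet> (y - x)"
          using min closure_subset by blast
        then show "v y \<ge> v y0 + (- (K *\<^sub>R e) + p) \<bullet> (y - y0)"
          by (simp add: w_def algebra_simps)
      qed
      ultimately show "- (K *\<^sub>R e) + p \<in> D" by (auto simp: D_def)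
    qed
  qed (use D in auto)
  also have "\<dots> = monge_ampere \<Omega> v E"
    using D by (simp add: monge_ampere_def D_def)
  finally show ?thesis using E E\<Omega> Eslab by blast
qed

lemma supporting_halfspace_at:
  fixes \<Omega> :: "'a::euclidean_space set"
  assumes "open \<Omega>" "convex \<Omega>" "z \<notin> \<Omega>"
  obtains e where "norm e = 1" "\<And>y. y \<in> \<Omega> \<Longrightarrow> 0 < e \<bullet> (y - z)"
proof (cases "\<Omega> = {}")
  case True
  obtain e :: 'a where "norm e = 1" using vector_choose_size[of 1] by auto
  with True that show ?thesis by auto
next
  case False
  then obtain a b where ab: "a \<noteq> 0" "\<forall>x\<in>{z}. a \<bullet> x \<le> b" "\<forall>x\<in>\<Omega>. b \<le> a \<bullet> x"
    using separating_hyperplane_sets[of "{z}" \<Omega>] assms by auto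
  define e where "e = (1 / norm a) *\<^sub>R a"
  have e: "norm e = 1" using ab by (simp add: e_def)
  have ge: "0 \<le> e \<bullet> (y - z)" if "y \<in> \<Omega>" for y
  proof -
    have "a \<bullet> z \<le> a \<bullet> y" using ab that by force
    then show ?thesis by (simp add: e_def inner_diff_right divide_right_mono)
  qed
  have "0 < e \<bullet> (y - z)" if y: "y \<in> \<Omega>" for y
  proof -
    obtain r where r: "r > 0" "ball y r \<subseteq> \<Omega>" using assms(1) y openE by metis
    have "y - (r / 2) *\<^sub>R e \<in> \<Omega>" using r e by (auto simp: subset_iff dist_norm)
    from ge[OF this] have "r / 2 \<le> e \<bullet> (y - z)"
      using e by (simp add: inner_diff_right norm_eq_1)
    then show ?thesis using r by simp
  qed
  with e that show ?thesis by blast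
qed

lemma ball_infdist_compl_subset:
  fixes x :: "'a::metric_space"
  shows "ball x (infdist x (- S)) \<subseteq> S"
proof
  fix y assume "y \<in> ball x (infdist x (- S))"
  then show "y \<in> S" using infdist_le[of y "- S" x] by auto
qed

lemma infdist_compl_pos:
  fixes \<Omega> :: "'a::euclidean_space set"
  assumes "open \<Omega>" "bounded \<Omega>" "x \<in> \<Omega>"
  shows "infdist x (- \<Omega>) > 0"
proof -
  have "- \<Omega> \<noteq> {}" using assms(2) not_bounded_UNIV by (metis Compl_empty_eq double_compl)
  then show ?thesis
    using assms in_closed_iff_infdist_zero[of "- \<Omega>" x] infdist_nonneg[of x "- \<Omega>"]
    by (auto simp: closed_open less_le)
qed

text \<open>With h = s^(n-1), where s^(n+1) is the distance to the boundary, the localised estimate bounds the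
  tilted value by a multiple of M (d h)^(1/n) = M s^2, and undoing the tilt costs M d/h = M s^2 as well.
  This balance determines h.\<close>

lemma eigenfunction_boundary_decay:
  fixes \<Omega> :: "'a::euclidean_space set"
  assumes \<Omega>: "open \<Omega>" "bounded \<Omega>" "convex \<Omega>" and lam: "ma_eigenvalue \<Omega> < \<infinity>"
  shows "\<exists>C\<ge>1. \<forall>v M x. ma_eigenfunction \<Omega> v \<longrightarrow> (\<forall>y\<in>\<Omega>. \<bar>v y\<bar> \<le> M) \<longrightarrow> x \<in> \<Omega> \<longrightarrow>
    \<bar>v x\<bar> \<le> C * M * (root (DIM('a) + 1) (infdist x (- \<Omega>)))\<^sup>2"
proof -
  define n where "n = DIM('a)"
  have n: "n \<ge> 1" by (simp add: n_def Suc_leI)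
  obtain L where L: "L \<ge> 0" "ma_eigenvalue \<Omega> = ennreal L"
    using lam by (cases "ma_eigenvalue \<Omega>") auto
  obtain R0 where R0: "\<And>y. y \<in> \<Omega> \<Longrightarrow> norm y \<le> R0" "R0 > 0"
    using \<Omega>(2) bounded_pos by metis
  define R where "R = 2 * R0"
  have R: "R > 0" and Rdiam: "\<And>x y. x \<in> \<Omega> \<Longrightarrow> y \<in> \<Omega> \<Longrightarrow> norm (y - x) \<le> R"
    using R0 norm_triangle_ineq4 unfolding R_def by (auto, smt (verit))
  define V where "V = measure lborel (cball (0::'a) (R0 + 1))"
  have V: "emeasure lborel (cball (0::'a) (R0 + 1)) = ennreal V" "V \<ge> 0"
    unfolding V_def
    using emeasure_bounded_finite[OF bounded_cball, of "0::'a" "R0 + 1"]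
    by (auto intro!: emeasure_eq_ennreal_measure)
  define \<omega> where "\<omega> = measure lborel (ball (0::'a) 1)"
  have \<omega>: "\<omega> > 0" unfolding \<omega>_def using content_ball_pos[of 1 "0::'a"] by simp
  \<comment> \<open>The constant in m^n \<le> const * M^n d h below; the maximum with 1 gives \<kappa> \<le> \<kappa>^n, so that no
    root has to be taken.\<close>
  define \<kappa> where "\<kappa> = max 1 (2 * (4 * R) ^ n * L * V / (\<omega> * R))"
  have \<kappa>: "\<kappa> \<ge> 1" "2 * (4 * R) ^ n * L * V / (\<omega> * R) \<le> \<kappa>" by (auto simp: \<kappa>_def)
  have main: "\<bar>v x\<bar> \<le> (\<kappa> + 1) * M * (root (n + 1) (infdist x (- \<Omega>)))\<^sup>2"
    if v: "ma_eigenfunction \<Omega> v" and M: "\<forall>y\<in>\<Omega>. \<bar>v y\<bar> \<le> M" and x: "x \<in> \<Omega>" for v M x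
  proof -
    have adm: "admissible \<Omega> v" and sol: "aleksandrov_solution \<Omega> (\<lambda>x. ma_eigenvalue \<Omega> * ennreal (\<bar>v x\<bar> ^ n)) v"
      using v by (auto simp: ma_eigenfunction_def n_def)
    have M0: "M \<ge> 0" using M x by force
    define s where "s = root (n + 1) (infdist x (- \<Omega>))"
    have s: "s > 0" unfolding s_def using infdist_compl_pos[OF \<Omega>(1,2) x] by simp
    have sd: "s ^ (n + 1) = infdist x (- \<Omega>)" unfolding s_def
      using infdist_nonneg by (intro real_root_pow_pos2) auto
    have "- \<Omega> \<noteq> {}" using \<Omega>(2) not_bounded_UNIV by (metis Compl_empty_eq double_compl)
    then obtain z where z: "z \<in> - \<Omega>" "infdist x (- \<Omega>) = dist x z"
      using infdist_attains_inf[of "- \<Omega>" x] \<Omega>(1) by (auto simp: closed_open)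
    obtain e where e: "norm e = 1" "\<And>y. y \<in> \<Omega> \<Longrightarrow> 0 < e \<bullet> (y - z)"
      using supporting_halfspace_at[OF \<Omega>(1,3)] z by (metis ComplD)
    define d where "d = e \<bullet> (x - z)"
    have d: "d > 0" using e x by (simp add: d_def)
    have ds: "d \<le> s ^ (n + 1)"
      unfolding sd z d_def using norm_cauchy_schwarz[of e "x - z"] e by (simp add: dist_norm)
    define h where "h = s ^ (n - 1)"
    have h: "h > 0" using s by (simp add: h_def)
    have hs: "s ^ (n + 1) = h * s\<^sup>2"
      using n by (simp add: h_def power_add[symmetric])
    define m where "m = - v x - M / h * d"
    have dh: "M / h * d \<le> M * s\<^sup>2"
    proof -
      have "M / h * d \<le> M / h * (h * s\<^sup>2)" using ds hs h M0 by (intro mult_left_mono) auto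
      then show ?thesis using h by simp
    qed
    have mle: "m \<le> \<kappa> * M * s\<^sup>2"
    proof (cases "m > 0")
      case False
      then show ?thesis using \<kappa> M0 by (smt (verit) mult_nonneg_nonneg zero_le_power2)
    next
      case True
      have low: "- M \<le> v y" if "y \<in> \<Omega>" for y
        using M that by (force simp: abs_le_iff)
      obtain E where E: "compact E" "E \<subseteq> \<Omega>" "\<forall>y\<in>E. e \<bullet> (y - z) < h"
        and le: "ennreal (R / (2 * d) * (m / (4 * R)) ^ n * \<omega>) \<le> monge_ampere \<Omega> v E"
        using aleksandrov_halfspace_estimate[OF \<Omega>(1,2) adm x R Rdiam[OF x] e(1) less_imp_le[OF e(2)] d_def d M0 low h m_def True]
        unfolding n_def \<omega>_def by blast
      have Eb: "E \<in> sets borel" using E(1) by (simp add: compact_imp_closed)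
      have "monge_ampere \<Omega> v E = (\<integral>\<^sup>+y\<in>E. (ma_eigenvalue \<Omega> * ennreal (\<bar>v y\<bar> ^ n)) \<partial>lborel)"
        using sol Eb E(2) unfolding aleksandrov_solution_def by blast
      also have "\<dots> \<le> (\<integral>\<^sup>+y. ennreal (L * M ^ n) * indicator E y \<partial>lborel)"
      proof (rule nn_integral_mono)
        fix y
        show "(ma_eigenvalue \<Omega> * ennreal (\<bar>v y\<bar> ^ n)) * indicator E y \<le> ennreal (L * M ^ n) * indicator E y"
          using E(2) M L M0
          by (auto split: split_indicator simp: ennreal_mult[symmetric] intro!: ennreal_leI mult_left_mono power_mono)
      qed
      also have "\<dots> = ennreal (L * M ^ n) * emeasure lborel E"
        using Eb by (simp add: nn_integral_cmult_indicator)
      also have "\<dots> \<le> ennreal (L * M ^ n) * (ennreal h * ennreal V)"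
        unfolding V(1)[symmetric]
      proof (intro mult_left_mono emeasure_slab_le[OF Eb _ e(1) h])
        show "E \<subseteq> cball 0 R0" using E R0 by auto
        show "0 \<le> e \<bullet> (y - z) \<and> e \<bullet> (y - z) < h" if "y \<in> E" for y
          using that E e(2)[of y] by force
      qed simp
      also have "\<dots> = ennreal (L * M ^ n * h * V)"
        using L M0 h V by (simp add: ennreal_mult mult.assoc)
      finally have "ennreal (R / (2 * d) * (m / (4 * R)) ^ n * \<omega>) \<le> ennreal (L * M ^ n * h * V)"
        using le by (rule order_trans[rotated])
      then have ineq: "R / (2 * d) * (m / (4 * R)) ^ n * \<omega> \<le> L * M ^ n * h * V"
        using L M0 h V by (subst (asm) ennreal_le_iff) auto
      have "m ^ n = (R / (2 * d) * (m / (4 * R)) ^ n * \<omega>) * (2 * d * (4 * R) ^ n / (\<omega> * R))"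
        using R d \<omega> by (simp add: power_divide field_simps)
      also have "\<dots> \<le> (L * M ^ n * h * V) * (2 * d * (4 * R) ^ n / (\<omega> * R))"
        using ineq R d \<omega> by (intro mult_right_mono) auto
      also have "\<dots> = (2 * (4 * R) ^ n * L * V / (\<omega> * R)) * (M ^ n * (d * h))"
        by simp
      also have "\<dots> \<le> \<kappa> * (M ^ n * (d * h))"
        using \<kappa> M0 d h by (intro mult_right_mono) auto
      also have "\<dots> \<le> \<kappa> ^ n * (M ^ n * (s ^ (n + 1) * h))"
        using \<kappa> M0 d h n ds self_le_power[of \<kappa> n] by (intro mult_mono) auto
      also have "s ^ (n + 1) * h = (s\<^sup>2) ^ n"
        unfolding h_def power_add[symmetric] power_mult[symmetric] using n by (simp add: mult_2)
      also have "\<kappa> ^ n * (M ^ n * (s\<^sup>2) ^ n) = (\<kappa> * M * s\<^sup>2) ^ n"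
        by (simp add: power_mult_distrib)
      finally have "m ^ n \<le> (\<kappa> * M * s\<^sup>2) ^ n" .
      then show ?thesis
        using n \<kappa> M0 by (intro power_le_imp_le_base[of m "n - 1"]) auto
    qed
    have "\<bar>v x\<bar> = - v x"
      using admissible_nonpos[OF \<Omega>(1,2) _ adm] x closure_subset by fastforce
    also have "\<dots> = m + M / h * d" by (simp add: m_def)
    also have "\<dots> \<le> (\<kappa> + 1) * M * s\<^sup>2" using mle dh by (simp add: distrib_right)
    finally show ?thesis by (simp add: s_def)
  qed
  show ?thesis
    using \<kappa> by (intro exI[of _ "\<kappa> + 1"] conjI allI impI main[unfolded n_def]) auto
qed

text \<open>If the eigenvalue were infinite, the Monge-Ampere measure of a small ball on which v does not vanish
  would be infinite. But the slopes of a convex function at points away from the boundary are bounded by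
  its oscillation.\<close>

lemma eigenfunction_imp_eigenvalue_finite:
  fixes \<Omega> :: "'a::euclidean_space set"
  assumes \<Omega>: "open \<Omega>" and v: "ma_eigenfunction \<Omega> v"
  shows "ma_eigenvalue \<Omega> < \<infinity>"
proof (rule ccontr)
  assume "\<not> ma_eigenvalue \<Omega> < \<infinity>"
  then have inf: "ma_eigenvalue \<Omega> = \<infinity>" by (simp add: less_top[symmetric])
  have adm: "admissible \<Omega> v"
    and sol: "aleksandrov_solution \<Omega> (\<lambda>x. ma_eigenvalue \<Omega> * ennreal (\<bar>v x\<bar> ^ DIM('a))) v"
    using v by (auto simp: ma_eigenfunction_def)
  have cont: "continuous_on \<Omega> v"
    using adm unfolding admissible_def by (meson closure_subset continuous_on_subset)
  obtain x where x: "x \<in> \<Omega>" "v x \<noteq> 0" using adm by (auto simp: admissible_def)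
  have "open (\<Omega> \<inter> v -` (- {0}))"
    using cont \<Omega> by (intro continuous_open_preimage) auto
  moreover have "x \<in> \<Omega> \<inter> v -` (- {0})" using x by simp
  ultimately obtain r where r: "r > 0" "cball x r \<subseteq> \<Omega> \<inter> v -` (- {0})"
    by (meson open_contains_cball_eq)
  define E where "E = cball x (r / 2)"
  have E: "E \<subseteq> \<Omega>" "\<And>y. y \<in> E \<Longrightarrow> v y \<noteq> 0" using r by (auto simp: E_def subset_iff)
  have "compact (v ` cball x r)"
    using r cont by (intro compact_continuous_image) (auto intro: continuous_on_subset)
  then obtain B where B: "\<And>y. y \<in> cball x r \<Longrightarrow> \<bar>v y\<bar> \<le> B"
    using compact_imp_bounded[of "v ` cball x r"] unfolding bounded_iff by fastforce
  have "(\<Union>y\<in>E. subdifferential \<Omega> v y) \<subseteq> cball 0 (4 * B / r)"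
  proof safe
    fix y p assume y: "y \<in> E" and p: "p \<in> subdifferential \<Omega> v y"
    show "p \<in> cball 0 (4 * B / r)"
    proof (cases "p = 0")
      case True
      have "B \<ge> 0" using B[of x] r by force
      then show ?thesis using r True by simp
    next
      case False
      define y' where "y' = y + (r / 2 / norm p) *\<^sub>R p"
      have "dist x y' \<le> dist x y + dist y y'" by (rule dist_triangle)
      also have "\<dots> \<le> r / 2 + r / 2"
        using y False r by (intro add_mono) (auto simp: E_def y'_def dist_norm)
      finally have y': "y' \<in> cball x r" by simp
      then have "v y' \<ge> v y + p \<bullet> (y' - y)" using p r by (auto simp: subdifferential_def)
      also have "p \<bullet> (y' - y) = r / 2 * norm p"
        using False by (simp add: y'_def dot_square_norm power2_eq_square)
      finally have "r / 2 * norm p \<le> 2 * B"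
        using B[OF y'] B[of y] y r by (auto simp: E_def abs_le_iff)
      then show ?thesis using r by (simp add: field_simps)
    qed
  qed
  then have "bounded (\<Union>y\<in>E. subdifferential \<Omega> v y)"
    using bounded_cball bounded_subset by blast
  moreover have "closed (\<Union>y\<in>E. subdifferential \<Omega> v y)"
    using E cont by (intro closed_subdifferential_image) (auto simp: E_def)
  ultimately have "monge_ampere \<Omega> v E < \<infinity>"
    using emeasure_bounded_finite by (simp add: monge_ampere_def borel_closed)
  moreover have "monge_ampere \<Omega> v E = (\<integral>\<^sup>+y\<in>E. (ma_eigenvalue \<Omega> * ennreal (\<bar>v y\<bar> ^ DIM('a))) \<partial>lborel)"
    using sol E(1) unfolding aleksandrov_solution_def by (auto simp: E_def)
  moreover have "\<dots> = (\<integral>\<^sup>+y. \<infinity> * indicator E y \<partial>lborel)"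
    using E(2) by (intro nn_integral_cong) (auto split: split_indicator simp: inf ennreal_top_mult)
  moreover have "\<dots> = \<infinity>"
  proof -
    have "emeasure lborel E \<noteq> 0"
    proof
      assume "emeasure lborel E = 0"
      moreover have "ball x (r / 2) \<subseteq> E" by (auto simp: E_def)
      ultimately have "emeasure lborel (ball x (r / 2)) = 0"
        by (metis E_def borel_closed closed_cball emeasure_mono le_zero_eq sets_lborel)
      then have "measure lborel (ball x (r / 2)) = 0" by (simp add: measure_def)
      then show False using content_ball_pos[of "r / 2" x] r by simp
    qed
    then show ?thesis
      by (subst nn_integral_cmult_indicator) (auto simp: E_def ennreal_top_mult)
  qed
  ultimately show False by simp
qed

section \<open>Weighted integrals of second differences\<close>

text \<open>The interplay of the two exponents: the weight is at most B s^(2k) where the slopes are at most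
  A / s^k, so g (1 + (q/A)^2) is bounded uniformly in s. The arctangent is the primitive of
  1 / (1 + y^2), and its boundedness replaces any control on the total change of slope.\<close>

lemma weighted_slope_increment_le:
  fixes A B R s g q1 q2 :: real
  assumes A: "A > 0" and B: "B \<ge> 0" and s: "0 < s" "s \<le> R"
    and g: "0 \<le> g" "g \<le> B * s ^ (2 * k)"
    and q: "q1 \<le> q2" "\<bar>q1\<bar> \<le> A / s ^ k" "\<bar>q2\<bar> \<le> A / s ^ k"
  shows "g * (q2 - q1) \<le> A * B * (1 + R ^ (2 * k)) * (arctan (q2 / A) - arctan (q1 / A))"
proof (cases "q1 = q2")
  case False
  then have "q1 / A < q2 / A" using q A by (simp add: divide_strict_right_mono)
  then obtain y where y: "q1 / A < y" "y < q2 / A"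
    and mvt: "arctan (q2 / A) - arctan (q1 / A) = (q2 / A - q1 / A) * inverse (1 + y\<^sup>2)"
    using MVT2[of "q1 / A" "q2 / A" arctan "\<lambda>y. inverse (1 + y\<^sup>2)"] DERIV_arctan by blast
  have "- (1 / s ^ k) \<le> q1 / A" "q2 / A \<le> 1 / s ^ k"
    using q A s by (auto simp: abs_le_iff field_simps)
  then have "\<bar>y\<bar> \<le> 1 / s ^ k" using y by linarith
  then have "\<bar>y\<bar>\<^sup>2 \<le> (1 / s ^ k)\<^sup>2" by (rule power_mono) simp
  also have "\<dots> = 1 / s ^ (2 * k)" by (simp add: power_divide power_mult[symmetric] mult.commute)
  finally have y2: "y\<^sup>2 \<le> 1 / s ^ (2 * k)" by simp
  have pos: "1 + y\<^sup>2 > 0" by (simp add: add_pos_nonneg)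
  have "g * (1 + y\<^sup>2) \<le> (B * s ^ (2 * k)) * (1 + 1 / s ^ (2 * k))"
    using g y2 B s by (intro mult_mono) auto
  also have "\<dots> = B * (s ^ (2 * k) + 1)" using s by (simp add: field_simps)
  also have "\<dots> \<le> B * (1 + R ^ (2 * k))"
    using s B power_mono[of s R "2 * k"] by (intro mult_left_mono) auto
  finally have "g \<le> B * (1 + R ^ (2 * k)) * inverse (1 + y\<^sup>2)"
    using pos by (simp add: field_simps)
  then have "g * (q2 - q1) \<le> B * (1 + R ^ (2 * k)) * inverse (1 + y\<^sup>2) * (q2 - q1)"
    using q by (intro mult_right_mono) auto
  also have "\<dots> = A * B * (1 + R ^ (2 * k)) * ((q2 / A - q1 / A) * inverse (1 + y\<^sup>2))"
  proof -
    have "q2 - q1 = A * (q2 / A - q1 / A)" using A by (simp add: right_diff_distrib)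
    then show ?thesis by (simp only: ac_simps)
  qed
  finally show ?thesis by (simp only: mvt)
qed simp

lemma nn_integral_lborel_shift:
  fixes f :: "'a::euclidean_space \<Rightarrow> ennreal"
  assumes "f \<in> borel_measurable borel"
  shows "(\<integral>\<^sup>+x. f (x + c) \<partial>lborel) = (\<integral>\<^sup>+x. f x \<partial>lborel)"
proof -
  have "(\<integral>\<^sup>+x. f x \<partial>lborel) = (\<integral>\<^sup>+x. f x \<partial>distr lborel borel ((+) c))"
    by (simp add: lborel_distr_plus)
  also have "\<dots> = (\<integral>\<^sup>+x. f (c + x) \<partial>lborel)"
    using assms by (intro nn_integral_distr) auto
  finally show ?thesis by (simp add: add.commute)
qed

text \<open>When F is dominated by the increment of a bounded function \<psi> along the translation by c, the
  integral over K cancels by translation invariance, except over the layer of K that the translation moves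
  out of K.\<close>

lemma nn_integral_telescoping_le:
  fixes \<psi> F :: "'a::euclidean_space \<Rightarrow> real"
  assumes K: "K \<in> sets borel" "bounded K" and \<psi>: "\<psi> \<in> borel_measurable borel"
    and F: "(\<lambda>x. F x * indicator K x) \<in> borel_measurable borel"
    and bd: "\<And>x. 0 \<le> \<psi> x" "\<And>x. \<psi> x \<le> P"
    and le: "\<And>x. x \<in> K \<Longrightarrow> 0 \<le> F x" "\<And>x. x \<in> K \<Longrightarrow> F x + \<psi> (x - c) \<le> \<psi> x"
  shows "(\<integral>\<^sup>+x. ennreal (F x * indicator K x) \<partial>lborel) \<le> ennreal P * emeasure lborel {x\<in>K. x + c \<notin> K}"
proof -
  note [measurable] = K(1) \<psi> F
  have shift[measurable]: "(\<lambda>x. x + c) \<in> borel_measurable borel" "(\<lambda>x. x - c) \<in> borel_measurable borel"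
    by simp_all
  define X where "X = {x\<in>K. x + c \<notin> K}"
  have X[measurable]: "X \<in> sets borel"
  proof -
    have "X = K - (\<lambda>x. x + c) -` K" by (auto simp: X_def)
    moreover have "(\<lambda>x. x + c) -` K \<in> sets borel"
      using measurable_sets[OF shift(1) K(1)] by simp
    ultimately show ?thesis by simp
  qed
  have P: "P \<ge> 0" using bd[of 0] by simp
  define a where "a = (\<integral>\<^sup>+x. ennreal (\<psi> (x - c)) * indicator K x \<partial>lborel)"
  have a_eq: "a = (\<integral>\<^sup>+x. ennreal (\<psi> x) * indicator K (x + c) \<partial>lborel)"
    using nn_integral_lborel_shift[of "\<lambda>x. ennreal (\<psi> (x - c)) * indicator K x" c]
    by (simp add: a_def)
  have "a \<le> (\<integral>\<^sup>+x. ennreal P * indicator K x \<partial>lborel)"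
    unfolding a_def using bd by (intro nn_integral_mono mult_right_mono ennreal_leI) auto
  also have "\<dots> = ennreal P * emeasure lborel K"
    by (rule nn_integral_cmult_indicator) simp
  also have "\<dots> < \<infinity>"
    using emeasure_bounded_finite[OF K(2)] by (simp add: ennreal_mult_less_top)
  finally have a: "a \<noteq> \<infinity>" by simp
  \<comment> \<open>The shifted integral a is added instead of subtracted, and cancelled at the end; for this it
    has to be finite.\<close>
  have "a + (\<integral>\<^sup>+x. ennreal (F x * indicator K x) \<partial>lborel)
      = (\<integral>\<^sup>+x. ennreal (\<psi> (x - c)) * indicator K x + ennreal (F x * indicator K x) \<partial>lborel)"
    unfolding a_def by (rule nn_integral_add[symmetric]) simp_all
  also have "\<dots> \<le> (\<integral>\<^sup>+x. ennreal (\<psi> x) * indicator K (x + c) + ennreal P * indicator X x \<partial>lborel)"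
  proof (rule nn_integral_mono)
    fix x
    show "ennreal (\<psi> (x - c)) * indicator K x + ennreal (F x * indicator K x)
       \<le> ennreal (\<psi> x) * indicator K (x + c) + ennreal P * indicator X x"
    proof (cases "x \<in> K")
      case True
      have "ennreal (\<psi> (x - c)) + ennreal (F x) = ennreal (F x + \<psi> (x - c))"
        using le(1)[OF True] bd by (simp add: ennreal_plus[symmetric] add.commute del: ennreal_plus)
      also have "\<dots> \<le> ennreal (\<psi> x)" using le(2)[OF True] by (rule ennreal_leI)
      finally show ?thesis
        using True bd[of x] by (auto simp: X_def indicator_def intro: order_trans ennreal_leI)
    qed simp
  qed
  also have "\<dots> = a + ennreal P * emeasure lborel X"
    by (subst nn_integral_add) (simp_all add: a_eq nn_integral_cmult_indicator)
  finally show ?thesis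
    using a ennreal_add_left_cancel_le[of a] by (auto simp: X_def)
qed

text \<open>By convexity the difference quotient grows with the step, and a step that reaches the sphere of
  radius d increases u by at most |u(x)|, as u is nonpositive. The point on the sphere itself may fall
  outside the domain, hence the passage to the limit from smaller steps.\<close>

lemma convex_nonpos_slope_le:
  fixes u :: "'a::real_normed_vector \<Rightarrow> real"
  assumes u: "convex_on \<Omega> u" "\<And>y. y \<in> \<Omega> \<Longrightarrow> u y \<le> 0" and x: "x \<in> \<Omega>"
    and t: "t > 0" "x + t *\<^sub>R b \<in> \<Omega>" and b: "norm b = 1" and d: "d > 0" "ball x d \<subseteq> \<Omega>"
  shows "(u (x + t *\<^sub>R b) - u x) / t \<le> \<bar>u x\<bar> / d"
proof (rule ccontr)
  define X where "X = (u (x + t *\<^sub>R b) - u x) / t"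
  assume "\<not> ?thesis"
  then have X: "\<bar>u x\<bar> / d < X" by (simp add: X_def)
  then have X0: "X > 0" using d by (smt (verit) divide_nonneg_pos)
  have Xt: "X * t = u (x + t *\<^sub>R b) - u x" using t by (simp add: X_def)
  have "d \<le> \<bar>u x\<bar> / X"
  proof (cases "d \<le> t")
    case True
    then have "X * d \<le> X * t" using X0 by simp
    also have "\<dots> \<le> \<bar>u x\<bar>" using Xt u(2)[OF t(2)] by linarith
    finally show ?thesis using X0 by (simp add: field_simps)
  next
    case False
    show ?thesis
    proof (rule dense_le_bounded[of t])
      fix l assume l: "t < l" "l < d"
      have xl: "x + l *\<^sub>R b \<in> \<Omega>" using d l t b by (auto simp: subset_iff dist_norm)
      have "x + t *\<^sub>R b = (1 - t / l) *\<^sub>R x + (t / l) *\<^sub>R (x + l *\<^sub>R b)"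
        using l t by (simp add: algebra_simps)
      then have "u (x + t *\<^sub>R b) \<le> (1 - t / l) * u x + (t / l) * u (x + l *\<^sub>R b)"
        using convex_onD[OF u(1), of "t / l" x "x + l *\<^sub>R b"] l t x xl by simp
      also have "\<dots> \<le> (1 - t / l) * u x"
        using mult_nonneg_nonpos[of "t / l", OF _ u(2)[OF xl]] l t by simp
      finally have "X * t \<le> (t / l) * \<bar>u x\<bar>"
        using u(2)[OF x] unfolding Xt by (simp add: algebra_simps)
      then have "X * l \<le> \<bar>u x\<bar>" using l t by (simp add: field_simps)
      then show "l \<le> \<bar>u x\<bar> / X" using X0 by (simp add: field_simps)
    qed (use False in auto)
  qed
  then show False using X X0 d by (simp add: field_simps)
qed

text \<open>The second difference of u is the increment over one step of the difference quotient q, so the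
  weighted second difference is dominated by the increment of a multiple of arctan(q/A) and the integral
  telescopes. What remains is the layer of points of K pushed out of K by one step. As K is convex,
  the further translates of this layer are disjoint, so its volume is at most t times that of a fixed
  ball. This cancels the remaining factor 1/t, and the bound does not depend on t.\<close>

lemma weighted_second_difference_integral_le:
  fixes \<Omega> :: "'a::euclidean_space set" and u g :: "'a \<Rightarrow> real"
  assumes \<Omega>: "open \<Omega>" "convex \<Omega>" and R: "\<Omega> \<subseteq> cball 0 R"
    and u: "continuous_on \<Omega> u" "convex_on \<Omega> u" "\<And>x. x \<in> \<Omega> \<Longrightarrow> u x \<le> 0"
    and g: "continuous_on \<Omega> g" "\<And>x. x \<in> \<Omega> \<Longrightarrow> 0 \<le> g x"
    and A: "A > 0" and B: "B \<ge> 0"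
    and s: "\<And>x. x \<in> \<Omega> \<Longrightarrow> 0 < s x" "\<And>x. x \<in> \<Omega> \<Longrightarrow> s x \<le> S" "\<And>x. x \<in> \<Omega> \<Longrightarrow> ball x (s x ^ (k + 2)) \<subseteq> \<Omega>"
    and us: "\<And>x. x \<in> \<Omega> \<Longrightarrow> \<bar>u x\<bar> \<le> A * (s x)\<^sup>2"
    and gs: "\<And>x. x \<in> \<Omega> \<Longrightarrow> g x \<le> B * s x ^ (2 * k)"
    and b: "norm b = 1" and t: "t > 0"
    and K: "K = {x. x \<in> \<Omega> \<and> x + t *\<^sub>R b \<in> \<Omega> \<and> x - t *\<^sub>R b \<in> \<Omega>}"
  shows "(\<lambda>x. g x * ((u (x + t *\<^sub>R b) + u (x - t *\<^sub>R b) - 2 * u x) / t\<^sup>2) * indicator K x) \<in> borel_measurable borel"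
   and "(\<integral>\<^sup>+x. ennreal (g x * ((u (x + t *\<^sub>R b) + u (x - t *\<^sub>R b) - 2 * u x) / t\<^sup>2) * indicator K x) \<partial>lborel)
     \<le> ennreal (A * B * (1 + S ^ (2 * k)) * pi) * emeasure lborel (cball (0::'a) (R + 1))"
proof -
  have K_eq: "K = \<Omega> \<inter> ((\<lambda>x. x + t *\<^sub>R b) -` \<Omega> \<inter> (\<lambda>x. x - t *\<^sub>R b) -` \<Omega>)"
    by (auto simp: K)
  have K\<Omega>: "K \<subseteq> \<Omega>" by (auto simp: K)
  have Kopen: "open K"
    unfolding K_eq using \<Omega>(1) by (intro open_Int open_vimage continuous_intros) auto
  then have Kb: "K \<in> sets borel" by simp
  have Kbd: "bounded K" using K\<Omega> R bounded_cball bounded_subset by metis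
  have Kconv: "x + r *\<^sub>R b \<in> K" if x: "x \<in> K" and y: "x + r' *\<^sub>R b \<in> K" and r: "0 \<le> r" "r \<le> r'" for x r r'
  proof (cases "r' = 0")
    case False
    then have r': "r' > 0" using r by simp
    have *: "z + r *\<^sub>R b \<in> \<Omega>" if "z \<in> \<Omega>" "z + r' *\<^sub>R b \<in> \<Omega>" for z
    proof -
      have "z + r *\<^sub>R b = (1 - r / r') *\<^sub>R z + (r / r') *\<^sub>R (z + r' *\<^sub>R b)"
        using r' by (simp add: algebra_simps)
      also have "\<dots> \<in> \<Omega>"
        using that r r' by (intro convexD[OF \<Omega>(2)]) auto
      finally show ?thesis .
    qed
    show ?thesis
      using *[of x] *[of "x + t *\<^sub>R b"] *[of "x - t *\<^sub>R b"] x y by (simp add: K algebra_simps)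
  qed (use x r in auto)
  have cu: "continuous_on K (\<lambda>x. u (x + t *\<^sub>R b))" "continuous_on K (\<lambda>x. u (x - t *\<^sub>R b))"
      "continuous_on K u" "continuous_on K g"
    using u(1) g(1) K\<Omega> by (auto simp: K intro!: continuous_on_compose2[OF u(1)] continuous_intros intro: continuous_on_subset)
  have meas: "(\<lambda>x. f x * indicator K x) \<in> borel_measurable borel" if "continuous_on K f" for f :: "'a \<Rightarrow> real"
    using borel_measurable_continuous_on_indicator[OF Kb that] by (simp add: mult.commute)
  show "(\<lambda>x. g x * ((u (x + t *\<^sub>R b) + u (x - t *\<^sub>R b) - 2 * u x) / t\<^sup>2) * indicator K x) \<in> borel_measurable borel"
    by (intro meas continuous_intros cu) (use t in auto)
  \<comment> \<open>Extension by zero, which makes the difference quotient measurable on the whole space.\<close>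
  define u0 where "u0 x = indicator \<Omega> x * u x" for x
  have u0m: "u0 \<in> borel_measurable borel"
    using borel_measurable_continuous_on_indicator[OF _ u(1)] \<Omega>(1) unfolding u0_def by simp
  have u0: "u0 x = u x" if "x \<in> \<Omega>" for x using that by (simp add: u0_def)
  define q where "q x = (u0 (x + t *\<^sub>R b) - u0 x) / t" for x
  define Q where "Q = A * B * (1 + S ^ (2 * k))"
  have Q: "Q \<ge> 0" unfolding Q_def using A B by (intro mult_nonneg_nonneg) auto
  \<comment> \<open>Adding pi / 2 makes the function nonnegative, as the telescoping argument works with
    nonnegative integrals.\<close>
  define \<psi> where "\<psi> x = Q * (arctan (q x / A) + pi / 2)" for x
  have \<psi>m: "\<psi> \<in> borel_measurable borel"
  proof -
    have [measurable]: "(\<lambda>x. u0 (x + t *\<^sub>R b)) \<in> borel_measurable borel"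
      by (rule measurable_compose[OF _ u0m]) simp
    have [measurable]: "u0 \<in> borel_measurable borel" by (rule u0m)
    have [measurable]: "arctan \<in> borel_measurable borel"
      by (intro borel_measurable_continuous_onI continuous_intros)
    show ?thesis unfolding \<psi>_def q_def by measurable
  qed
  define F where "F x = g x * ((u (x + t *\<^sub>R b) + u (x - t *\<^sub>R b) - 2 * u x) / t)" for x
  have Fm: "(\<lambda>x. F x * indicator K x) \<in> borel_measurable borel"
    unfolding F_def by (intro meas continuous_intros cu) (use t in auto)
  have \<psi>bd: "0 \<le> \<psi> x" "\<psi> x \<le> Q * pi" for x
    unfolding \<psi>_def using Q arctan_lbound[of "q x / A"] arctan_ubound[of "q x / A"]
    by (auto intro!: mult_nonneg_nonneg mult_left_mono)
  have Fle: "0 \<le> F x \<and> F x + \<psi> (x - t *\<^sub>R b) \<le> \<psi> x" if x: "x \<in> K" for x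
  proof -
    have x\<Omega>: "x \<in> \<Omega>" "x + t *\<^sub>R b \<in> \<Omega>" "x - t *\<^sub>R b \<in> \<Omega>" using x by (auto simp: K)
    define q1 where "q1 = (u x - u (x - t *\<^sub>R b)) / t"
    define q2 where "q2 = (u (x + t *\<^sub>R b) - u x) / t"
    have q: "q (x - t *\<^sub>R b) = q1" "q x = q2"
      using x\<Omega> by (auto simp: q_def q1_def q2_def u0)
    have "u x \<le> u (x - t *\<^sub>R b) / 2 + u (x + t *\<^sub>R b) / 2"
    proof -
      have "x = (1 - 1 / 2) *\<^sub>R (x - t *\<^sub>R b) + (1 / 2) *\<^sub>R (x + t *\<^sub>R b)"
        by (simp add: algebra_simps scaleR_2[symmetric])
      then show ?thesis
        using convex_onD[OF u(2), of "1 / 2" "x - t *\<^sub>R b" "x + t *\<^sub>R b"] x\<Omega> by simp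
    qed
    then have q12: "q1 \<le> q2" unfolding q1_def q2_def using t by (intro divide_right_mono) auto
    have F: "F x = g x * (q2 - q1)"
      by (simp add: F_def q1_def q2_def diff_divide_distrib[symmetric] algebra_simps)
    have sx: "s x > 0" using s x\<Omega> by simp
    have "\<bar>u x\<bar> / s x ^ (k + 2) \<le> A * (s x)\<^sup>2 / s x ^ (k + 2)"
      using us[OF x\<Omega>(1)] sx by (intro divide_right_mono) auto
    also have "\<dots> = A / s x ^ k" using sx by (simp add: power_add power2_eq_square)
    finally have slope: "\<bar>u x\<bar> / s x ^ (k + 2) \<le> A / s x ^ k" .
    have "q2 \<le> A / s x ^ k"
      unfolding q2_def using convex_nonpos_slope_le[OF u(2,3) x\<Omega>(1) t x\<Omega>(2) b _ s(3)] sx x\<Omega> slope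
      by force
    moreover have "- q1 \<le> A / s x ^ k"
      unfolding q1_def using convex_nonpos_slope_le[OF u(2,3) x\<Omega>(1) t _ _ _ s(3), of "- b"] sx x\<Omega> slope b
      by (force simp: minus_divide_left)
    ultimately have qb: "\<bar>q1\<bar> \<le> A / s x ^ k" "\<bar>q2\<bar> \<le> A / s x ^ k"
      using q12 by auto
    have "F x \<le> Q * (arctan (q2 / A) - arctan (q1 / A))"
      unfolding F Q_def using A B sx s(2) x\<Omega> g(2) gs q12 qb
      by (intro weighted_slope_increment_le[of A B "s x"]) auto
    moreover have "0 \<le> F x" unfolding F using g(2)[OF x\<Omega>(1)] q12 by simp
    ultimately show ?thesis by (simp add: \<psi>_def q algebra_simps)
  qed
  define X where "X = {x \<in> K. x + t *\<^sub>R b \<notin> K}"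
  have X: "X \<in> sets borel"
  proof -
    have "X = K - (\<lambda>x. x + t *\<^sub>R b) -` K" by (auto simp: X_def)
    moreover have "open ((\<lambda>x. x + t *\<^sub>R b) -` K)"
      using Kopen by (intro open_vimage continuous_intros)
    ultimately show ?thesis using Kopen by simp
  qed
  have "(\<integral>\<^sup>+x. ennreal (F x * indicator K x) \<partial>lborel) \<le> ennreal (Q * pi) * emeasure lborel X"
    unfolding X_def
    by (rule nn_integral_telescoping_le[OF Kb Kbd \<psi>m Fm \<psi>bd]) (use Fle in auto)
  also have "\<dots> \<le> ennreal (Q * pi) * (ennreal t * emeasure lborel (cball (0::'a) (R + 1)))"
  proof (intro mult_left_mono emeasure_le_step_mult[OF X _ t, where c = b])
    fix j :: nat and a assume a: "a \<in> X"
    show "a + (real j * t) *\<^sub>R b \<in> cball 0 (R + 1)" if "real j * t \<le> 1"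
    proof -
      have "norm a \<le> R" using a R K\<Omega> by (auto simp: X_def)
      moreover have "norm ((real j * t) *\<^sub>R b) \<le> 1" using that t b by simp
      ultimately show ?thesis using norm_triangle_ineq[of a "(real j * t) *\<^sub>R b"] by simp
    qed
    show "a + (real j * t) *\<^sub>R b \<notin> X" if "0 < j"
    proof
      assume "a + (real j * t) *\<^sub>R b \<in> X"
      moreover have "t \<le> real j * t" using that t by simp
      ultimately show False using Kconv[of a "real j * t" t] a t by (auto simp: X_def)
    qed
  qed auto
  finally have le: "(\<integral>\<^sup>+x. ennreal (F x * indicator K x) \<partial>lborel)
     \<le> ennreal (Q * pi) * (ennreal t * emeasure lborel (cball (0::'a) (R + 1)))" .
  have "(\<integral>\<^sup>+x. ennreal (g x * ((u (x + t *\<^sub>R b) + u (x - t *\<^sub>R b) - 2 * u x) / t\<^sup>2) * indicator K x) \<partial>lborel)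
     = (\<integral>\<^sup>+x. ennreal (1 / t) * ennreal (F x * indicator K x) \<partial>lborel)"
    using t by (intro nn_integral_cong) (simp add: F_def ennreal_mult'[symmetric] power2_eq_square)
  also have "\<dots> = ennreal (1 / t) * (\<integral>\<^sup>+x. ennreal (F x * indicator K x) \<partial>lborel)"
    using Fm by (intro nn_integral_cmult) simp
  also have "\<dots> \<le> ennreal (1 / t) * (ennreal (Q * pi) * (ennreal t * emeasure lborel (cball (0::'a) (R + 1))))"
    using le by (rule mult_left_mono) simp
  also have "\<dots> = ennreal (Q * pi) * ((ennreal (1 / t) * ennreal t) * emeasure lborel (cball (0::'a) (R + 1)))"
    by (simp only: ac_simps)
  also have "ennreal (1 / t) * ennreal t = 1"
    using t by (simp add: ennreal_mult'[symmetric])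
  finally show "(\<integral>\<^sup>+x. ennreal (g x * ((u (x + t *\<^sub>R b) + u (x - t *\<^sub>R b) - 2 * u x) / t\<^sup>2) * indicator K x) \<partial>lborel)
     \<le> ennreal (A * B * (1 + S ^ (2 * k)) * pi) * emeasure lborel (cball (0::'a) (R + 1))"
    by (simp add: Q_def)
qed

section \<open>From second differences to the Laplacian\<close>

text \<open>Both numerator and denominator vanish at t = 0, and the quotient of their derivatives is the symmetric
  difference quotient of the first derivative, which converges because that derivative is differentiable at
  x.\<close>

lemma second_difference_tendsto:
  fixes u :: "'a::euclidean_space \<Rightarrow> real"
  assumes u: "twice_differentiable_at u x" and b: "b \<in> Basis"
  shows "((\<lambda>t. (u (x + t *\<^sub>R b) + u (x - t *\<^sub>R b) - 2 * u x) / t\<^sup>2)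
    \<longlongrightarrow> frechet_derivative (\<lambda>y. frechet_derivative u (at y) b) (at x) b) (at_right 0)"
proof -
  define G where "G y = frechet_derivative u (at y) b" for y
  define D where "D = frechet_derivative G (at x) b"
  have nb: "norm b = 1" using b by simp
  obtain \<delta> where \<delta>: "\<delta> > 0" "\<And>y. y \<in> ball x \<delta> \<Longrightarrow> u differentiable (at y)"
    using u unfolding twice_differentiable_at_def eventually_nhds_metric by (auto simp: dist_commute)
  have "G differentiable (at x)"
    using u b unfolding twice_differentiable_at_def G_def[abs_def] by blast
  then have GD: "(G has_derivative frechet_derivative G (at x)) (at x)"
    by (simp add: frechet_derivative_works)
  have along: "((\<lambda>t. f (x + t *\<^sub>R c)) has_real_derivative f' c) (at t)"
    if "(f has_derivative f') (at (x + t *\<^sub>R c))" for f :: "'a \<Rightarrow> real" and f' c t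
  proof -
    have "((\<lambda>t. f (x + t *\<^sub>R c)) has_derivative (\<lambda>h. f' (h *\<^sub>R c))) (at t)"
      by (rule has_derivative_compose[where f = "\<lambda>t. x + t *\<^sub>R c", OF _ that])
        (auto intro!: derivative_eq_intros)
    moreover have "f' (h *\<^sub>R c) = f' c * h" for h
      using linear_scale[OF has_derivative_linear[OF that]] by (simp add: mult.commute)
    ultimately show ?thesis
      by (simp add: has_field_derivative_def mult.commute[of _ "f' c"])
  qed
  have uD: "((\<lambda>t. u (x + t *\<^sub>R b) + u (x - t *\<^sub>R b) - 2 * u x) has_real_derivative
      (G (x + t *\<^sub>R b) - G (x - t *\<^sub>R b))) (at t)" if t: "\<bar>t\<bar> < \<delta>" for t
  proof -
    have "(u has_derivative frechet_derivative u (at (x + t *\<^sub>R b))) (at (x + t *\<^sub>R b))"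
      using \<delta>(2)[of "x + t *\<^sub>R b"] t nb by (simp add: frechet_derivative_works[symmetric] dist_norm)
    from along[OF this] have 1: "((\<lambda>t. u (x + t *\<^sub>R b)) has_real_derivative G (x + t *\<^sub>R b)) (at t)"
      by (simp add: G_def)
    have *: "(u has_derivative frechet_derivative u (at (x + t *\<^sub>R (- b)))) (at (x + t *\<^sub>R (- b)))"
      using \<delta>(2)[of "x - t *\<^sub>R b"] t nb by (simp add: frechet_derivative_works[symmetric] dist_norm)
    have "frechet_derivative u (at (x - t *\<^sub>R b)) (- b) = - G (x - t *\<^sub>R b)"
      using linear_neg[OF has_derivative_linear[OF *]] by (simp add: G_def)
    with along[OF *] have 2: "((\<lambda>t. u (x - t *\<^sub>R b)) has_real_derivative - G (x - t *\<^sub>R b)) (at t)"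
      by simp
    show ?thesis
      by (rule derivative_eq_intros 1 2 refl | simp)+
  qed
  have "((\<lambda>t. G (x + t *\<^sub>R b) - G (x + t *\<^sub>R (- b))) has_real_derivative (D - - D)) (at 0)"
  proof (rule DERIV_diff)
    show "((\<lambda>t. G (x + t *\<^sub>R b)) has_real_derivative D) (at 0)"
      unfolding D_def by (rule along) (simp add: GD)
    have "- D = frechet_derivative G (at x) (- b)"
      unfolding D_def using linear_neg[OF has_derivative_linear[OF GD]] by simp
    then show "((\<lambda>t. G (x + t *\<^sub>R (- b))) has_real_derivative (- D)) (at 0)"
      using along[of G "frechet_derivative G (at x)" 0 "- b"] GD by simp
  qed
  then have "((\<lambda>t. (G (x + t *\<^sub>R b) - G (x - t *\<^sub>R b)) / t) \<longlongrightarrow> 2 * D) (at 0)"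
    by (simp add: DERIV_def)
  then have "((\<lambda>t. (G (x + t *\<^sub>R b) - G (x - t *\<^sub>R b)) / t / 2) \<longlongrightarrow> 2 * D / 2) (at 0)"
    by (rule tendsto_divide) auto
  then have lim: "((\<lambda>t. (G (x + t *\<^sub>R b) - G (x - t *\<^sub>R b)) / (2 * t)) \<longlongrightarrow> D) (at_right 0)"
    by (auto simp: field_simps intro: filterlim_mono at_within_le_at)
  have ev: "\<forall>\<^sub>F t in at_right 0. 0 < t \<and> t < \<delta>"
    using \<delta>(1) by (auto simp: eventually_at_right_field)
  have "((\<lambda>t. (u (x + t *\<^sub>R b) + u (x - t *\<^sub>R b) - 2 * u x) / t\<^sup>2) \<longlongrightarrow> D) (at_right 0)"
  proof (rule lhopital_right_0[OF _ _ _ _ _ _ lim])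
    have "isCont (\<lambda>t. u (x + t *\<^sub>R b) + u (x - t *\<^sub>R b) - 2 * u x) 0"
      using uD[of 0] \<delta> by (intro DERIV_isCont) auto
    then show "((\<lambda>t. u (x + t *\<^sub>R b) + u (x - t *\<^sub>R b) - 2 * u x) \<longlongrightarrow> 0) (at_right 0)"
      by (auto simp: isCont_def intro: filterlim_mono at_within_le_at)
    have "((\<lambda>t::real. t\<^sup>2) \<longlongrightarrow> 0\<^sup>2) (at_right 0)"
      by (intro tendsto_intros)
    then show "((\<lambda>t::real. t\<^sup>2) \<longlongrightarrow> 0) (at_right 0)" by simp
    show "\<forall>\<^sub>F t::real in at_right 0. t\<^sup>2 \<noteq> 0" "\<forall>\<^sub>F t::real in at_right 0. 2 * t \<noteq> 0"
      by (rule eventually_mono[OF ev]; simp)+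
    show "\<forall>\<^sub>F t in at_right 0. ((\<lambda>t. u (x + t *\<^sub>R b) + u (x - t *\<^sub>R b) - 2 * u x) has_real_derivative
      (G (x + t *\<^sub>R b) - G (x - t *\<^sub>R b))) (at t)"
      by (rule eventually_mono[OF ev]) (use uD in auto)
    show "\<forall>\<^sub>F t::real in at_right 0. ((\<lambda>t. t\<^sup>2) has_real_derivative 2 * t) (at t)"
      by (intro always_eventually allI) (auto intro!: derivative_eq_intros)
  qed
  then show ?thesis by (simp add: D_def G_def[abs_def])
qed

lemma ennreal_sum_le: "ennreal (\<Sum>i\<in>I. f i) \<le> (\<Sum>i\<in>I. ennreal (f i))"
proof -
  have "ennreal (\<Sum>i\<in>I. f i) \<le> ennreal (\<Sum>i\<in>I. max 0 (f i))"
    by (intro ennreal_leI sum_mono) auto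
  also have "\<dots> = (\<Sum>i\<in>I. ennreal (max 0 (f i)))"
    by (rule sum_ennreal[symmetric]) auto
  also have "\<dots> = (\<Sum>i\<in>I. ennreal (f i))"
    by (intro sum.cong refl) (auto simp: max_def ennreal_neg)
  finally show ?thesis .
qed

text \<open>At points where u is not twice differentiable the Laplacian is 0 by convention, and the right-hand side
  is nonnegative. Everywhere else the quotients converge. Fatou's lemma is then applied to the
  right-hand side, whose terms are measurable.\<close>

lemma laplacian_le_liminf:
  fixes u g :: "'a::euclidean_space \<Rightarrow> real"
  assumes \<Omega>: "open \<Omega>" "x \<in> \<Omega>" and g: "0 \<le> g x"
    and t: "\<And>i. t i > 0" "t \<longlonglongrightarrow> 0"
    and K: "\<And>r b. K r b = {x. x \<in> \<Omega> \<and> x + r *\<^sub>R b \<in> \<Omega> \<and> x - r *\<^sub>R b \<in> \<Omega>}"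
  shows "ennreal (laplacian u x * g x) \<le> liminf (\<lambda>i. \<Sum>b\<in>Basis.
     ennreal (g x * ((u (x + t i *\<^sub>R b) + u (x - t i *\<^sub>R b) - 2 * u x) / (t i)\<^sup>2) * indicator (K (t i) b) x))"
proof (cases "twice_differentiable_at u x")
  case True
  define D where "D b = frechet_derivative (\<lambda>y. frechet_derivative u (at y) b) (at x) b" for b
  have tl: "filterlim t (at_right 0) sequentially"
    using t by (auto simp: filterlim_at less_imp_neq[OF t(1), symmetric])
  have "(\<lambda>i. ennreal (g x * ((u (x + t i *\<^sub>R b) + u (x - t i *\<^sub>R b) - 2 * u x) / (t i)\<^sup>2) * indicator (K (t i) b) x))
      \<longlonglongrightarrow> ennreal (g x * D b)" if b: "b \<in> Basis" for b
  proof -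
    have "(\<lambda>i. (u (x + t i *\<^sub>R b) + u (x - t i *\<^sub>R b) - 2 * u x) / (t i)\<^sup>2) \<longlonglongrightarrow> D b"
      using filterlim_compose[OF second_difference_tendsto[OF True b] tl] by (simp add: D_def)
    then have lim: "(\<lambda>i. g x * ((u (x + t i *\<^sub>R b) + u (x - t i *\<^sub>R b) - 2 * u x) / (t i)\<^sup>2)) \<longlonglongrightarrow> g x * D b"
      by (rule tendsto_mult_left)
    have ev: "\<forall>\<^sub>F i in sequentially. x \<in> K (t i) b"
    proof -
      have "(\<lambda>i. x + t i *\<^sub>R b) \<longlonglongrightarrow> x + 0 *\<^sub>R b" "(\<lambda>i. x - t i *\<^sub>R b) \<longlonglongrightarrow> x - 0 *\<^sub>R b"
        by (intro tendsto_intros t)+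
      then have "\<forall>\<^sub>F i in sequentially. x + t i *\<^sub>R b \<in> \<Omega>" "\<forall>\<^sub>F i in sequentially. x - t i *\<^sub>R b \<in> \<Omega>"
        using \<Omega> by (auto dest: topological_tendstoD)
      then show ?thesis
        by eventually_elim (use \<Omega> in \<open>auto simp: K\<close>)
    qed
    show ?thesis
    proof (rule tendsto_ennrealI, rule Lim_transform_eventually[OF lim])
      show "\<forall>\<^sub>F i in sequentially. g x * ((u (x + t i *\<^sub>R b) + u (x - t i *\<^sub>R b) - 2 * u x) / (t i)\<^sup>2)
        = g x * ((u (x + t i *\<^sub>R b) + u (x - t i *\<^sub>R b) - 2 * u x) / (t i)\<^sup>2) * indicator (K (t i) b) x"
        using ev by eventually_elim simp
    qed
  qed
  then have "(\<lambda>i. \<Sum>b\<in>Basis. ennreal (g x * ((u (x + t i *\<^sub>R b) + u (x - t i *\<^sub>R b) - 2 * u x) / (t i)\<^sup>2) * indicator (K (t i) b) x))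
      \<longlonglongrightarrow> (\<Sum>b\<in>Basis. ennreal (g x * D b))"
    by (intro tendsto_sum) auto
  from lim_imp_Liminf[OF _ this]
  have "liminf (\<lambda>i. \<Sum>b\<in>Basis. ennreal (g x * ((u (x + t i *\<^sub>R b) + u (x - t i *\<^sub>R b) - 2 * u x) / (t i)\<^sup>2) * indicator (K (t i) b) x))
      = (\<Sum>b\<in>Basis. ennreal (g x * D b))" by simp
  moreover have "laplacian u x * g x = (\<Sum>b\<in>Basis. g x * D b)"
    using True by (simp add: laplacian_def D_def sum_distrib_left mult.commute)
  ultimately show ?thesis using ennreal_sum_le by metis
qed (simp add: laplacian_def)

text \<open>The set where a continuous function exceeds its essential supremum is open and null, hence
  empty.\<close>

lemma sup_abs_le_Linf_norm:
  fixes u :: "'a::euclidean_space \<Rightarrow> real"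
  assumes \<Omega>: "open \<Omega>" and u: "continuous_on \<Omega> u" and x: "x \<in> \<Omega>"
  shows "ennreal \<bar>u x\<bar> \<le> Linf_norm \<Omega> u"
proof (rule ccontr)
  define L where "L = Linf_norm \<Omega> u"
  assume "\<not> ?thesis"
  then have L: "L < ennreal \<bar>u x\<bar>" by (simp add: L_def)
  define U where "U = \<Omega> \<inter> (\<lambda>y. ennreal \<bar>u y\<bar>) -` {L<..}"
  have U: "open U"
    unfolding U_def using \<Omega> u by (intro continuous_open_preimage continuous_on_ennreal continuous_intros) auto
  have "AE y in restrict_space lborel \<Omega>. ennreal \<bar>u y\<bar> \<le> L"
    unfolding L_def Linf_norm_def by (rule esssup_AE)
  then have "AE y in lborel. y \<in> \<Omega> \<longrightarrow> ennreal \<bar>u y\<bar> \<le> L"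
    using \<Omega> by (subst (asm) AE_restrict_space_iff) auto
  then have "AE y in lborel. y \<notin> U"
    by eventually_elim (auto simp: U_def)
  then have "emeasure lborel U = 0"
    using U by (subst (asm) AE_iff_measurable[of U]) auto
  then have "negligible U"
    using U by (simp add: negligible_iff_null_sets null_sets_completionI null_sets_def)
  then have "U = {}"
    using U open_not_negligible by blast
  moreover have "x \<in> U" using L x by (simp add: U_def)
  ultimately show False by simp
qed

lemma admissible_attains_sup_norm:
  fixes u :: "'a::euclidean_space \<Rightarrow> real"
  assumes \<Omega>: "open \<Omega>" "bounded \<Omega>" and u: "admissible \<Omega> u"
  obtains M where "M > 0" "\<And>y. y \<in> \<Omega> \<Longrightarrow> \<bar>u y\<bar> \<le> M" "ennreal M \<le> Linf_norm \<Omega> u"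
proof -
  have cont: "continuous_on (closure \<Omega>) u" and bd: "\<And>x. x \<in> frontier \<Omega> \<Longrightarrow> u x = 0"
    using u by (auto simp: admissible_def)
  obtain y where y: "y \<in> \<Omega>" "u y \<noteq> 0" using u by (auto simp: admissible_def)
  have "compact (closure \<Omega>)" "closure \<Omega> \<noteq> {}" using \<Omega> y by auto
  moreover have "continuous_on (closure \<Omega>) (\<lambda>x. \<bar>u x\<bar>)" by (intro continuous_intros cont)
  ultimately obtain x where x: "x \<in> closure \<Omega>" and max: "\<And>z. z \<in> closure \<Omega> \<Longrightarrow> \<bar>u z\<bar> \<le> \<bar>u x\<bar>"
    using continuous_attains_sup[of "closure \<Omega>" "\<lambda>x. \<bar>u x\<bar>"] by blast
  have pos: "\<bar>u x\<bar> > 0" using max[of y] y closure_subset by fastforce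
  then have "x \<in> \<Omega>" using x bd[of x] \<Omega>(1) by (auto simp: frontier_def interior_open)
  moreover have "continuous_on \<Omega> u" using cont closure_subset by (rule continuous_on_subset)
  ultimately have "ennreal \<bar>u x\<bar> \<le> Linf_norm \<Omega> u"
    using sup_abs_le_Linf_norm[OF \<Omega>(1)] by blast
  with that pos max closure_subset show ?thesis by blast
qed

section \<open>The Laplacian estimate\<close>

lemma eigenfunction_laplacian_estimate:
  fixes \<Omega> :: "'a::euclidean_space set"
  assumes \<Omega>: "open \<Omega>" "bounded \<Omega>" "convex \<Omega>"
  shows "\<exists>C::real. \<forall>u v. ma_eigenfunction \<Omega> u \<longrightarrow> ma_eigenfunction \<Omega> v \<longrightarrow>
    (\<integral>\<^sup>+x\<in>\<Omega>. ennreal (laplacian u x * \<bar>v x\<bar> ^ (DIM('a) - 1)) \<partial>lborel)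
      \<le> ennreal C * Linf_norm \<Omega> u * Linf_norm \<Omega> v ^ (DIM('a) - 1)"
proof (cases "\<exists>w. ma_eigenfunction \<Omega> w")
  case True
  then have lam: "ma_eigenvalue \<Omega> < \<infinity>"
    using eigenfunction_imp_eigenvalue_finite[OF \<Omega>(1)] by blast
  define k where "k = DIM('a) - 1"
  have k: "DIM('a) + 1 = k + 2" using DIM_positive[where 'a='a] by (simp add: k_def)
  define s where "s x = root (k + 2) (infdist x (- \<Omega>))" for x
  obtain C0 where C0: "C0 \<ge> 1" and decay:
    "\<And>v M x. ma_eigenfunction \<Omega> v \<Longrightarrow> \<forall>y\<in>\<Omega>. \<bar>v y\<bar> \<le> M \<Longrightarrow> x \<in> \<Omega> \<Longrightarrow> \<bar>v x\<bar> \<le> C0 * M * (s x)\<^sup>2"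
    using eigenfunction_boundary_decay[OF \<Omega> lam] unfolding k s_def by blast
  obtain R where "\<forall>x\<in>\<Omega>. norm x \<le> R" using \<Omega>(2) by (auto simp: bounded_iff)
  then have R: "\<Omega> \<subseteq> cball 0 R" by auto
  obtain w where w: "w \<in> - \<Omega>" using \<Omega>(2) not_bounded_UNIV by (metis UNIV_eq_I ComplI)
  define S where "S = root (k + 2) (R + norm w)"
  have s_pow: "s x ^ (k + 2) = infdist x (- \<Omega>)" for x
    unfolding s_def by (intro real_root_pow_pos2 infdist_nonneg) simp
  have s_pos: "0 < s x" if "x \<in> \<Omega>" for x
    unfolding s_def using infdist_compl_pos[OF \<Omega>(1,2) that] by simp
  have s_le: "s x \<le> S" if "x \<in> \<Omega>" for x
  proof -
    have "infdist x (- \<Omega>) \<le> norm (x - w)" using infdist_le[OF w, of x] by (simp add: dist_norm)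
    also have "\<dots> \<le> R + norm w" using norm_triangle_ineq4[of x w] R that by fastforce
    finally show ?thesis unfolding s_def S_def by simp
  qed
  have s_ball: "ball x (s x ^ (k + 2)) \<subseteq> \<Omega>" for x
    unfolding s_pow by (rule ball_infdist_compl_subset)
  define V where "V = measure lborel (cball (0::'a) (R + 1))"
  have V: "emeasure lborel (cball (0::'a) (R + 1)) = ennreal V" "V \<ge> 0"
    unfolding V_def
    using emeasure_bounded_finite[OF bounded_cball, of "0::'a" "R + 1"]
    by (auto intro!: emeasure_eq_ennreal_measure)
  define C where "C = real DIM('a) * (C0 * C0 ^ k * (1 + S ^ (2 * k)) * pi * V)"
  have C: "C \<ge> 0"
    unfolding C_def using C0 V by (intro mult_nonneg_nonneg add_nonneg_nonneg) auto
  have main: "(\<integral>\<^sup>+x\<in>\<Omega>. ennreal (laplacian u x * \<bar>v x\<bar> ^ k) \<partial>lborel)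
      \<le> ennreal C * Linf_norm \<Omega> u * Linf_norm \<Omega> v ^ k"
    if u: "ma_eigenfunction \<Omega> u" and v: "ma_eigenfunction \<Omega> v" for u v
  proof -
    have adm: "admissible \<Omega> u" "admissible \<Omega> v" using u v by (auto simp: ma_eigenfunction_def)
    obtain Mu where Mu: "Mu > 0" "\<And>y. y \<in> \<Omega> \<Longrightarrow> \<bar>u y\<bar> \<le> Mu" "ennreal Mu \<le> Linf_norm \<Omega> u"
      using admissible_attains_sup_norm[OF \<Omega>(1,2) adm(1)] by blast
    obtain Mv where Mv: "Mv > 0" "\<And>y. y \<in> \<Omega> \<Longrightarrow> \<bar>v y\<bar> \<le> Mv" "ennreal Mv \<le> Linf_norm \<Omega> v"
      using admissible_attains_sup_norm[OF \<Omega>(1,2) adm(2)] by blast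
    have cont: "continuous_on \<Omega> u" "continuous_on \<Omega> v" and conv: "convex_on \<Omega> u"
      using adm closure_subset unfolding admissible_def by (blast intro: continuous_on_subset)+
    have u0: "u x \<le> 0" if "x \<in> \<Omega>" for x
      using admissible_nonpos[OF \<Omega>(1,2) _ adm(1), of x] that closure_subset by blast
    define g where "g x = \<bar>v x\<bar> ^ k" for x
    have g: "continuous_on \<Omega> g" "\<And>x. 0 \<le> g x"
      unfolding g_def by (auto intro!: continuous_intros cont)
    have us: "\<bar>u x\<bar> \<le> (C0 * Mu) * (s x)\<^sup>2" if "x \<in> \<Omega>" for x
      using decay[OF u _ that] Mu by blast
    have gs: "g x \<le> (C0 * Mv) ^ k * s x ^ (2 * k)" if "x \<in> \<Omega>" for x
    proof -
      have "g x \<le> (C0 * Mv * (s x)\<^sup>2) ^ k"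
        unfolding g_def using decay[OF v _ that] Mv by (intro power_mono) auto
      then show ?thesis by (simp add: power_mult_distrib power_mult)
    qed
    define K where "K r b = {x. x \<in> \<Omega> \<and> x + r *\<^sub>R b \<in> \<Omega> \<and> x - r *\<^sub>R b \<in> \<Omega>}" for r and b :: 'a
    define t where "t i = inverse (real (Suc i))" for i
    have t: "\<And>i. t i > 0" "t \<longlonglongrightarrow> 0"
      unfolding t_def by (simp, rule LIMSEQ_inverse_real_of_nat)
    define f where "f i b x = g x * ((u (x + t i *\<^sub>R b) + u (x - t i *\<^sub>R b) - 2 * u x) / (t i)\<^sup>2) * indicator (K (t i) b) x"
      for i b x
    define Q where "Q = (C0 * Mu) * (C0 * Mv) ^ k * (1 + S ^ (2 * k)) * pi"
    have Q: "Q \<ge> 0"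
      unfolding Q_def using C0 Mu Mv by (intro mult_nonneg_nonneg add_nonneg_nonneg) auto
    have f: "f i b \<in> borel_measurable borel" "(\<integral>\<^sup>+x. ennreal (f i b x) \<partial>lborel) \<le> ennreal Q * ennreal V"
      if b: "b \<in> Basis" for i b
    proof -
      note est = weighted_second_difference_integral_le[OF \<Omega>(1,3) R cont(1) conv u0 g _ _ s_pos s_le s_ball us gs _ t(1)[of i] K_def,
          of b]
      show "f i b \<in> borel_measurable borel"
        unfolding f_def[abs_def] by (rule est(1)) (use b C0 Mu Mv in auto)
      show "(\<integral>\<^sup>+x. ennreal (f i b x) \<partial>lborel) \<le> ennreal Q * ennreal V"
        unfolding f_def Q_def V(1)[symmetric] by (rule est(2)) (use b C0 Mu Mv in auto)
    qed
    have "(\<integral>\<^sup>+x\<in>\<Omega>. ennreal (laplacian u x * \<bar>v x\<bar> ^ k) \<partial>lborel)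
       \<le> (\<integral>\<^sup>+x. liminf (\<lambda>i. \<Sum>b\<in>Basis. ennreal (f i b x)) \<partial>lborel)"
    proof (rule nn_integral_mono)
      fix x
      show "ennreal (laplacian u x * \<bar>v x\<bar> ^ k) * indicator \<Omega> x \<le> liminf (\<lambda>i. \<Sum>b\<in>Basis. ennreal (f i b x))"
      proof (cases "x \<in> \<Omega>")
        case True
        show ?thesis
          using laplacian_le_liminf[OF \<Omega>(1) True g(2) t K_def, of u] True
          by (simp add: f_def g_def)
      qed simp
    qed
    also have "\<dots> \<le> liminf (\<lambda>i. \<integral>\<^sup>+x. (\<Sum>b\<in>Basis. ennreal (f i b x)) \<partial>lborel)"
      using f(1) by (intro nn_integral_liminf borel_measurable_sum measurable_compose[OF _ measurable_ennreal]) simp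
    also have "\<dots> \<le> liminf (\<lambda>i::nat. \<Sum>b\<in>(Basis::'a set). ennreal Q * ennreal V)"
    proof (rule Liminf_mono, intro always_eventually allI)
      fix i
      have "(\<integral>\<^sup>+x. (\<Sum>b\<in>Basis. ennreal (f i b x)) \<partial>lborel) = (\<Sum>b\<in>Basis. \<integral>\<^sup>+x. ennreal (f i b x) \<partial>lborel)"
        using f(1) by (intro nn_integral_sum measurable_compose[OF _ measurable_ennreal]) simp
      also have "\<dots> \<le> (\<Sum>b\<in>(Basis::'a set). ennreal Q * ennreal V)"
        by (intro sum_mono f(2))
      finally show "(\<integral>\<^sup>+x. (\<Sum>b\<in>Basis. ennreal (f i b x)) \<partial>lborel) \<le> (\<Sum>b\<in>(Basis::'a set). ennreal Q * ennreal V)" .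
    qed
    also have "\<dots> = ennreal (real DIM('a) * (Q * V))"
      using Q V by (simp add: Liminf_const ennreal_mult ennreal_of_nat_eq_real_of_nat)
    also have "real DIM('a) * (Q * V) = C * Mu * Mv ^ k"
      by (simp add: C_def Q_def power_mult_distrib)
    also have "ennreal (C * Mu * Mv ^ k) = ennreal C * ennreal Mu * ennreal Mv ^ k"
      using C Mu Mv by (simp add: ennreal_mult ennreal_power)
    also have "\<dots> \<le> ennreal C * Linf_norm \<Omega> u * Linf_norm \<Omega> v ^ k"
      using Mu Mv by (intro mult_mono power_mono) auto
    finally show ?thesis .
  qed
  then show ?thesis unfolding k_def by blast
qed auto

theorem lemma1p8:
  fixes \<Omega> :: "(real ^ 'n) set"
  assumes "CARD('n) \<ge> 2"
    and "open \<Omega>" and "bounded \<Omega>" and "convex \<Omega>" and "\<Omega> \<noteq> {}"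
  shows "\<exists>C::real. \<forall>u v. ma_eigenfunction \<Omega> u \<longrightarrow> ma_eigenfunction \<Omega> v \<longrightarrow>
    (\<integral>\<^sup>+x\<in>\<Omega>. ennreal (laplacian u x * \<bar>v x\<bar> ^ (CARD('n) - 1)) \<partial>lborel)
      \<le> ennreal C * Linf_norm \<Omega> u * Linf_norm \<Omega> v ^ (CARD('n) - 1)"
  using eigenfunction_laplacian_estimate[OF assms(2-4)] by simp

end
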